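(* For all expressions $e,f$, we have: \begin{equation*} \mathcal{C}_E \models H \rightarrow e \leq f \iff H^*[\![e]\!]_E \subseteq H^*[\![f]\!]_E\enspace. \end{equation*}
   Context: Fix a signature $\Sigma$, a set $X$ of variables, and a set $E$ of linear and regular term equations (each variable occurs at most once on each side, and the same variables occur on both sides). Expressions are built from variables, the symbols of $\Sigma$, a constant $0$, a binary $+$, and least fixpoints $\mu x.e$ (closed expressions: all recursion variables bound). Atoms are terms over $\Sigma$ and $X$ quotiented by the equational theory of $E$; languages are sets of atoms; they form a continuous model of $E$ under pointwise-lifted operations. The standard language interpretation $[\![e]\!]_E$ of an expression $e$ is its interpretation in this language model under the valuation $x\mapsto\{x\}$ ($0$ as $\emptyset$, $+$ as union, $\mu$ as least fixpoint). A continuous model of $E$ is a model of $E$ whose carrier is a complete lattice and whose operations preserve arbitrary joins in each argument; $\mathcal{C}_E \models H \rightarrow e \leq f$ means that in every continuous model of $E$, every valuation satisfying all inequations of $H$ also satisfies $e\leq f$. Fix a set $H$ of hypotheses (inequations between expressions). A context $C$ is an atom represented by a term with exactly one occurrence of a designated hole variable; $Ca$ denotes plugging atom $a$ in the hole and $CL=\{Ca\mid a\in L\}$. Define $H(L)=\bigcup\{C[\![e]\!]_E \mid C \text{ a context},\ (e\leq f)\in H,\ C[\![f]\!]_E\subseteq L\}$; a language $L$ is $H$-closed if $H(L)\subseteq L$, and $H^*(L)$ is the least $H$-closed language containing $L$. *)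

theory Defs
  imports "HOL-Algebra.Complete_Lattice" "HOL.Hull"
begin

datatype ('f, 'v) trm = Var 'v | Fun 'f "('f, 'v) trm list"

text \<open>A signature is a set of pairs of a symbol and its arity.\<close>

type_synonym 'f signature = "('f \<times> nat) set"

fun trm_over :: "'f signature \<Rightarrow> 'v set \<Rightarrow> ('f, 'v) trm \<Rightarrow> bool" where
  "trm_over \<Sigma> V (Var v) = (v \<in> V)"
| "trm_over \<Sigma> V (Fun g ts) = ((g, length ts) \<in> \<Sigma> \<and> (\<forall>t\<in>set ts. trm_over \<Sigma> V t))"

text \<open>The list of variable occurrences, from left to right.\<close>

fun occs :: "('f, 'v) trm \<Rightarrow> 'v list" where
  "occs (Var v) = [v]"
| "occs (Fun g ts) = concat (map occs ts)"

fun tsubst :: "('v \<Rightarrow> ('f, 'w) trm) \<Rightarrow> ('f, 'v) trm \<Rightarrow> ('f, 'w) trm" where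
  "tsubst \<sigma> (Var v) = \<sigma> v"
| "tsubst \<sigma> (Fun g ts) = Fun g (map (tsubst \<sigma>) ts)"

fun teval :: "('f \<Rightarrow> 'a list \<Rightarrow> 'a) \<Rightarrow> ('v \<Rightarrow> 'a) \<Rightarrow> ('f, 'v) trm \<Rightarrow> 'a" where
  "teval I \<nu> (Var v) = \<nu> v"
| "teval I \<nu> (Fun g ts) = I g (map (teval I \<nu>) ts)"

type_synonym ('f, 'v) equations = "(('f, 'v) trm \<times> ('f, 'v) trm) set"

definition linear_regular :: "'f signature \<Rightarrow> ('f, 'v) equations \<Rightarrow> bool" where
  "linear_regular \<Sigma> E \<longleftrightarrow>
     (\<forall>(l, r)\<in>E. trm_over \<Sigma> UNIV l \<and> trm_over \<Sigma> UNIV r \<and>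
        distinct (occs l) \<and> distinct (occs r) \<and> set (occs l) = set (occs r))"

text \<open>
  The equational theory of \<open>E\<close> on the terms over \<open>V\<close>. The variables of the equations
  may live in a type different from that of the variables of the terms.
\<close>

inductive_set eq_theory ::
  "'f signature \<Rightarrow> ('f, 'v) equations \<Rightarrow> 'w set \<Rightarrow> (('f, 'w) trm \<times> ('f, 'w) trm) set"
  for \<Sigma> :: "'f signature" and E :: "('f, 'v) equations" and V :: "'w set" where
  refl: "trm_over \<Sigma> V t \<Longrightarrow> (t, t) \<in> eq_theory \<Sigma> E V"
| sym: "(s, t) \<in> eq_theory \<Sigma> E V \<Longrightarrow> (t, s) \<in> eq_theory \<Sigma> E V"
| trans: "(s, t) \<in> eq_theory \<Sigma> E V \<Longrightarrow> (t, u) \<in> eq_theory \<Sigma> E V \<Longrightarrow> (s, u) \<in> eq_theory \<Sigma> E V"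
| cong: "(g, length ts) \<in> \<Sigma> \<Longrightarrow> list_all2 (\<lambda>t u. (t, u) \<in> eq_theory \<Sigma> E V) ts us \<Longrightarrow>
    (Fun g ts, Fun g us) \<in> eq_theory \<Sigma> E V"
| inst: "(l, r) \<in> E \<Longrightarrow> (\<And>v. trm_over \<Sigma> V (\<sigma> v)) \<Longrightarrow>
    (tsubst \<sigma> l, tsubst \<sigma> r) \<in> eq_theory \<Sigma> E V"

type_synonym ('f, 'x) atom = "('f, 'x) trm set"
type_synonym ('f, 'x) lang = "('f, 'x) atom set"

definition atoms :: "'f signature \<Rightarrow> ('f, 'v) equations \<Rightarrow> 'w set \<Rightarrow> ('f, 'w) atom set" where
  "atoms \<Sigma> E V = {t. trm_over \<Sigma> V t} // eq_theory \<Sigma> E V"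

definition atom_of ::
    "'f signature \<Rightarrow> ('f, 'v) equations \<Rightarrow> 'w set \<Rightarrow> ('f, 'w) trm \<Rightarrow> ('f, 'w) atom" where
  "atom_of \<Sigma> E V t = eq_theory \<Sigma> E V `` {t}"

definition atom_op :: "'f signature \<Rightarrow> ('f, 'v) equations \<Rightarrow> 'w set \<Rightarrow>
    'f \<Rightarrow> ('f, 'w) atom list \<Rightarrow> ('f, 'w) atom" where
  "atom_op \<Sigma> E V g as = (\<Union>ts\<in>{ts. list_all2 (\<in>) ts as}. atom_of \<Sigma> E V (Fun g ts))"

text \<open>
  Recursion variables form a separate class of names: only they can be bound, and only
  they matter for closedness.
\<close>

datatype ('f, 'x) expr =
    EVar 'x
  | RVar nat
  | EFun 'f "('f, 'x) expr list"
  | Zero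
  | Plus "('f, 'x) expr" "('f, 'x) expr"
  | Mu nat "('f, 'x) expr"

fun expr_over :: "'f signature \<Rightarrow> 'x set \<Rightarrow> ('f, 'x) expr \<Rightarrow> bool" where
  "expr_over \<Sigma> X (EVar x) = (x \<in> X)"
| "expr_over \<Sigma> X (RVar r) = True"
| "expr_over \<Sigma> X (EFun g es) = ((g, length es) \<in> \<Sigma> \<and> (\<forall>e\<in>set es. expr_over \<Sigma> X e))"
| "expr_over \<Sigma> X Zero = True"
| "expr_over \<Sigma> X (Plus e f) = (expr_over \<Sigma> X e \<and> expr_over \<Sigma> X f)"
| "expr_over \<Sigma> X (Mu r e) = expr_over \<Sigma> X e"

fun free_rvars :: "('f, 'x) expr \<Rightarrow> nat set" where
  "free_rvars (EVar x) = {}"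
| "free_rvars (RVar r) = {r}"
| "free_rvars (EFun g es) = (\<Union>e\<in>set es. free_rvars e)"
| "free_rvars Zero = {}"
| "free_rvars (Plus e f) = free_rvars e \<union> free_rvars f"
| "free_rvars (Mu r e) = free_rvars e - {r}"

definition closed_expr :: "'f signature \<Rightarrow> 'x set \<Rightarrow> ('f, 'x) expr \<Rightarrow> bool" where
  "closed_expr \<Sigma> X e \<longleftrightarrow> expr_over \<Sigma> X e \<and> free_rvars e = {}"

text \<open>\<open>\<rho>\<close> is the valuation proper, \<open>\<eta>\<close> the environment for the recursion variables.\<close>

fun interp_env :: "'a gorder \<Rightarrow> ('f \<Rightarrow> 'a list \<Rightarrow> 'a) \<Rightarrow> ('x \<Rightarrow> 'a) \<Rightarrow>
    (nat \<Rightarrow> 'a) \<Rightarrow> ('f, 'x) expr \<Rightarrow> 'a" where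
  "interp_env L I \<rho> \<eta> (EVar x) = \<rho> x"
| "interp_env L I \<rho> \<eta> (RVar r) = \<eta> r"
| "interp_env L I \<rho> \<eta> (EFun g es) = I g (map (interp_env L I \<rho> \<eta>) es)"
| "interp_env L I \<rho> \<eta> Zero = \<bottom>\<^bsub>L\<^esub>"
| "interp_env L I \<rho> \<eta> (Plus e f) = interp_env L I \<rho> \<eta> e \<squnion>\<^bsub>L\<^esub> interp_env L I \<rho> \<eta> f"
| "interp_env L I \<rho> \<eta> (Mu r e) = LEAST_FP L (\<lambda>a. interp_env L I \<rho> (\<eta>(r := a)) e)"

text \<open>On closed expressions the initial environment is irrelevant.\<close>

definition interp :: "'a gorder \<Rightarrow> ('f \<Rightarrow> 'a list \<Rightarrow> 'a) \<Rightarrow> ('x \<Rightarrow> 'a) \<Rightarrow> ('f, 'x) expr \<Rightarrow> 'a" where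
  "interp L I \<rho> e = interp_env L I \<rho> (\<lambda>_. \<bottom>\<^bsub>L\<^esub>) e"

text \<open>
  The joins that are preserved include the empty one, so operations are strict in each
  argument.
\<close>

definition continuous_model :: "'f signature \<Rightarrow> ('f, 'v) equations \<Rightarrow>
    'a gorder \<Rightarrow> ('f \<Rightarrow> 'a list \<Rightarrow> 'a) \<Rightarrow> bool" where
  "continuous_model \<Sigma> E L I \<longleftrightarrow>
     complete_lattice L \<and>
     (\<forall>(g, n)\<in>\<Sigma>. \<forall>as. length as = n \<and> set as \<subseteq> carrier L \<longrightarrow> I g as \<in> carrier L) \<and>
     (\<forall>(g, n)\<in>\<Sigma>. \<forall>as i A. length as = n \<and> set as \<subseteq> carrier L \<and> i < n \<and> A \<subseteq> carrier L \<longrightarrow>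
        I g (as[i := \<Squnion>\<^bsub>L\<^esub> A]) = \<Squnion>\<^bsub>L\<^esub> ((\<lambda>a. I g (as[i := a])) ` A)) \<and>
     (\<forall>(l, r)\<in>E. \<forall>\<nu>. (\<forall>v. \<nu> v \<in> carrier L) \<longrightarrow> teval I \<nu> l = teval I \<nu> r)"

type_synonym ('f, 'x) inequations = "(('f, 'x) expr \<times> ('f, 'x) expr) set"

text \<open>
  Validity of \<open>H \<rightarrow> e \<le> f\<close> in all continuous models of \<open>E\<close> whose carrier is a set of
  elements of the type \<open>'a\<close>. A formula cannot quantify over types, so validity in the
  class of all continuous models is validity for every instance of \<open>'a\<close>; the canonical
  model, whose elements are the \<open>H\<close>-closed languages, has its carrier in the type of languages.
\<close>

definition entails :: "'a itself \<Rightarrow> 'f signature \<Rightarrow> 'x set \<Rightarrow> ('f, 'v) equations \<Rightarrow>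
    ('f, 'x) inequations \<Rightarrow> ('f, 'x) expr \<Rightarrow> ('f, 'x) expr \<Rightarrow> bool" where
  "entails (_ :: 'a itself) \<Sigma> X E H e f \<longleftrightarrow>
     (\<forall>(L :: 'a gorder) I \<rho>. continuous_model \<Sigma> E L I \<longrightarrow> (\<forall>x\<in>X. \<rho> x \<in> carrier L) \<longrightarrow>
        (\<forall>(e', f')\<in>H. interp L I \<rho> e' \<sqsubseteq>\<^bsub>L\<^esub> interp L I \<rho> f') \<longrightarrow>
        interp L I \<rho> e \<sqsubseteq>\<^bsub>L\<^esub> interp L I \<rho> f)"

definition lang_lattice ::
    "'f signature \<Rightarrow> ('f, 'v) equations \<Rightarrow> 'x set \<Rightarrow> ('f, 'x) lang gorder" where
  "lang_lattice \<Sigma> E X = \<lparr>carrier = Pow (atoms \<Sigma> E X), eq = (=), le = (\<subseteq>)\<rparr>"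

definition lang_op :: "'f signature \<Rightarrow> ('f, 'v) equations \<Rightarrow> 'x set \<Rightarrow>
    'f \<Rightarrow> ('f, 'x) lang list \<Rightarrow> ('f, 'x) lang" where
  "lang_op \<Sigma> E X g Ls = {atom_op \<Sigma> E X g as | as. list_all2 (\<in>) as Ls}"

definition lang_of :: "'f signature \<Rightarrow> ('f, 'v) equations \<Rightarrow> 'x set \<Rightarrow>
    ('f, 'x) expr \<Rightarrow> ('f, 'x) lang" where
  "lang_of \<Sigma> E X e =
     interp (lang_lattice \<Sigma> E X) (lang_op \<Sigma> E X) (\<lambda>x. {atom_of \<Sigma> E X (Var x)}) e"

text \<open>Contexts are atoms over the variables \<open>Some x\<close> with \<open>x \<in> X\<close>, and the hole \<open>None\<close>.\<close>

definition contexts ::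
    "'f signature \<Rightarrow> ('f, 'v) equations \<Rightarrow> 'x set \<Rightarrow> ('f, 'x option) atom set" where
  "contexts \<Sigma> E X =
     {C \<in> atoms \<Sigma> E (insert None (Some ` X)). \<exists>c\<in>C. count_list (occs c) None = 1}"

definition fill :: "('f, 'x option) trm \<Rightarrow> ('f, 'x) trm \<Rightarrow> ('f, 'x) trm" where
  "fill c t = tsubst (\<lambda>v. case v of None \<Rightarrow> t | Some x \<Rightarrow> Var x) c"

definition plug :: "'f signature \<Rightarrow> ('f, 'v) equations \<Rightarrow> 'x set \<Rightarrow>
    ('f, 'x option) atom \<Rightarrow> ('f, 'x) atom \<Rightarrow> ('f, 'x) atom" where
  "plug \<Sigma> E X C a = (\<Union>c\<in>C. \<Union>t\<in>a. atom_of \<Sigma> E X (fill c t))"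

definition hyp_step :: "'f signature \<Rightarrow> ('f, 'v) equations \<Rightarrow> 'x set \<Rightarrow>
    ('f, 'x) inequations \<Rightarrow> ('f, 'x) lang \<Rightarrow> ('f, 'x) lang" where
  "hyp_step \<Sigma> E X H L =
     \<Union>{plug \<Sigma> E X C ` lang_of \<Sigma> E X e | C e f.
         C \<in> contexts \<Sigma> E X \<and> (e, f) \<in> H \<and> plug \<Sigma> E X C ` lang_of \<Sigma> E X f \<subseteq> L}"

definition hyp_closed :: "'f signature \<Rightarrow> ('f, 'v) equations \<Rightarrow> 'x set \<Rightarrow>
    ('f, 'x) inequations \<Rightarrow> ('f, 'x) lang \<Rightarrow> bool" where
  "hyp_closed \<Sigma> E X H L \<longleftrightarrow> L \<subseteq> atoms \<Sigma> E X \<and> hyp_step \<Sigma> E X H L \<subseteq> L"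

definition hyp_closure :: "'f signature \<Rightarrow> ('f, 'v) equations \<Rightarrow> 'x set \<Rightarrow>
    ('f, 'x) inequations \<Rightarrow> ('f, 'x) lang \<Rightarrow> ('f, 'x) lang" where
  "hyp_closure \<Sigma> E X H L = hyp_closed \<Sigma> E X H hull L"

end

theory Submission
  imports Defs
begin

text \<open>
  A valuation in a continuous model extends to a join-preserving map \<open>lift\<close> from languages to the
  carrier. Continuity of the operations and fusion of least fixpoints show that it commutes with
  the interpretation of expressions. Its right adjoint \<open>below\<close> sends every element to an
  \<open>H\<close>-closed language when the model satisfies \<open>H\<close>, because contexts are continuous in their hole;
  this gives soundness. For completeness, the \<open>H\<close>-closed languages, with the closures of the
  pointwise operations, form a continuous model of \<open>E\<close> (linearity and regularity transfer the
  equations from atoms to languages). There \<open>lift\<close> is the closure operator, so that \<open>H\<close> holds and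
  the interpretation of \<open>e\<close> is the closure of its language.
\<close>

section \<open>Terms and atoms\<close>

text \<open>A hypothesis holds in a model without any mention of contexts, yet
  \<open>hyp_closure\<close> closes under all of them. What bridges this is that a context has
  exactly one hole. In a continuous model its value then preserves joins in the hole, so plugging a
  whole language amounts to evaluating the context at the single element \<open>lift M\<close>; with
  two holes, mixed terms would contribute as well. On languages, an operation with atoms in its
  other arguments turns a context into a context, so closures of arguments are absorbed by an outer
  closure. Continuity of the closed operations rests on this absorption. Linearity matters because
  two occurrences of a variable would pick atoms of its language independently; regularity matters
  because a variable on one side only, valued by the empty language, makes that side empty but need
  not affect the other. Fusion of fixpoints is proved once, for arbitrary continuous models; its
  instance at the closed languages spares completeness an induction over expressions.\<close>

lemma occs_subset: "trm_over \<Sigma> V t \<Longrightarrow> set (occs t) \<subseteq> V"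
  by (induction t) auto

lemma trm_over_tsubst:
  assumes "trm_over \<Sigma> V t" and "\<And>v. v \<in> set (occs t) \<Longrightarrow> trm_over \<Sigma> W (\<sigma> v)"
  shows "trm_over \<Sigma> W (tsubst \<sigma> t)"
  using assms by (induction t) auto

lemma tsubst_cong: "(\<And>v. v \<in> set (occs t) \<Longrightarrow> \<sigma> v = \<tau> v) \<Longrightarrow> tsubst \<sigma> t = tsubst \<tau> t"
  by (induction t) auto

lemma tsubst_tsubst: "tsubst \<tau> (tsubst \<sigma> t) = tsubst (\<lambda>v. tsubst \<tau> (\<sigma> v)) t"
  by (induction t) auto

lemma tsubst_Var [simp]: "tsubst Var t = t"
  by (induction t) (auto simp: map_idI)

lemma set_occs_tsubst: "set (occs (tsubst \<sigma> t)) = (\<Union>v\<in>set (occs t). set (occs (\<sigma> v)))"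
  by (induction t) auto

lemma teval_cong: "(\<And>v. v \<in> set (occs t) \<Longrightarrow> \<nu> v = \<nu>' v) \<Longrightarrow> teval I \<nu> t = teval I \<nu>' t"
proof (induction t)
  case (Fun g ts)
  then have "\<forall>t\<in>set ts. teval I \<nu> t = teval I \<nu>' t"
    by auto
  then show ?case
    by (simp cong: map_cong)
qed simp

lemma teval_tsubst: "teval I \<nu> (tsubst \<sigma> t) = teval I (\<lambda>v. teval I \<nu> (\<sigma> v)) t"
  by (induction t) (auto intro!: arg_cong[where f = "I _"])

locale linear_regular_theory =
  fixes \<Sigma> :: "'f signature" and E :: "('f, 'v) equations"
  assumes linear_regular: "linear_regular \<Sigma> E"
begin

lemma equation_over: "(l, r) \<in> E \<Longrightarrow> trm_over \<Sigma> UNIV l \<and> trm_over \<Sigma> UNIV r"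
  using linear_regular by (auto simp: linear_regular_def)

lemma eq_theory_over: "(s, t) \<in> eq_theory \<Sigma> E V \<Longrightarrow> trm_over \<Sigma> V s \<and> trm_over \<Sigma> V t"
proof (induction rule: eq_theory.induct)
  case (cong g ts us)
  then show ?case by (auto simp: list_all2_conv_all_nth all_set_conv_all_nth)
next
  case (inst l r \<sigma>)
  then show ?case using equation_over by (blast intro: trm_over_tsubst)
qed auto

lemma equiv_eq_theory: "equiv {t. trm_over \<Sigma> V t} (eq_theory \<Sigma> E V)"
  by (rule equivI) (auto intro!: refl_onI symI transI intro: eq_theory.intros dest: eq_theory_over)

lemma atom_of_eq_iff:
  "trm_over \<Sigma> V s \<Longrightarrow> trm_over \<Sigma> V t \<Longrightarrow>
    atom_of \<Sigma> E V s = atom_of \<Sigma> E V t \<longleftrightarrow> (s, t) \<in> eq_theory \<Sigma> E V"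
  unfolding atom_of_def by (rule eq_equiv_class_iff[OF equiv_eq_theory]) auto

lemma atoms_eq: "atoms \<Sigma> E V = atom_of \<Sigma> E V ` {t. trm_over \<Sigma> V t}"
  by (auto simp: atoms_def atom_of_def quotient_def)

lemma atom_of_in_atoms: "trm_over \<Sigma> V t \<Longrightarrow> atom_of \<Sigma> E V t \<in> atoms \<Sigma> E V"
  by (auto simp: atoms_eq)

lemma mem_atom_of: "s \<in> atom_of \<Sigma> E V t \<longleftrightarrow> (t, s) \<in> eq_theory \<Sigma> E V"
  by (simp add: atom_of_def)

lemma atom_list_rep:
  assumes "set as \<subseteq> atoms \<Sigma> E V"
  obtains ts where "as = map (atom_of \<Sigma> E V) ts" "\<forall>t\<in>set ts. trm_over \<Sigma> V t"
proof -
  have "as \<in> lists (atom_of \<Sigma> E V ` {t. trm_over \<Sigma> V t})"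
    using assms by (auto simp: atoms_eq)
  then show thesis
    using that by (auto simp: lists_image)
qed

text \<open>The union in \<open>atom_op\<close> ranges over all choices of representatives.
  Congruence puts their results in one class, and \<open>ts\<close> itself is such a choice, so the
  union is not empty.\<close>

lemma atom_op_atom_of:
  assumes "(g, length ts) \<in> \<Sigma>" "\<forall>t\<in>set ts. trm_over \<Sigma> V t"
  shows "atom_op \<Sigma> E V g (map (atom_of \<Sigma> E V) ts) = atom_of \<Sigma> E V (Fun g ts)"
proof -
  have "atom_of \<Sigma> E V (Fun g us) = atom_of \<Sigma> E V (Fun g ts)"
    if us: "list_all2 (\<in>) us (map (atom_of \<Sigma> E V) ts)" for us
  proof -
    have 1: "list_all2 (\<lambda>t u. (t, u) \<in> eq_theory \<Sigma> E V) ts us"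
      using us by (auto simp: list_all2_conv_all_nth mem_atom_of)
    with assms have "(Fun g ts, Fun g us) \<in> eq_theory \<Sigma> E V"
      by (auto intro: eq_theory.cong)
    then show ?thesis
      using eq_theory_over by (metis atom_of_eq_iff)
  qed
  moreover have "list_all2 (\<in>) ts (map (atom_of \<Sigma> E V) ts)"
    using assms by (auto simp: list_all2_conv_all_nth mem_atom_of intro: eq_theory.refl)
  ultimately show ?thesis
    unfolding atom_op_def by blast
qed

lemma eq_theory_tsubst:
  assumes "(s, t) \<in> eq_theory \<Sigma> E V" "\<And>v. v \<in> V \<Longrightarrow> trm_over \<Sigma> W (\<tau> v)"
  shows "(tsubst \<tau> s, tsubst \<tau> t) \<in> eq_theory \<Sigma> E W"
  using assms(1)
proof (induction rule: eq_theory.induct)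
  case (refl t)
  have "v \<in> set (occs t) \<Longrightarrow> trm_over \<Sigma> W (\<tau> v)" for v
    using occs_subset[OF refl] assms(2) by auto
  with refl show ?case
    by (auto intro: eq_theory.refl trm_over_tsubst)
next
  case (cong g ts us)
  then show ?case by (auto intro!: eq_theory.cong simp: list_all2_conv_all_nth)
next
  case (inst l r \<sigma>)
  have "trm_over \<Sigma> W (tsubst \<tau> (\<sigma> v))" for v
    using inst(2)[of v] occs_subset[OF inst(2)[of v]] assms(2)
    by (blast intro: trm_over_tsubst)
  with inst show ?case
    by (auto simp: tsubst_tsubst intro: eq_theory.inst)
qed (blast intro: eq_theory.sym eq_theory.trans)+

lemma tsubst_eq_theory:
  assumes "trm_over \<Sigma> V t" "\<And>v. v \<in> V \<Longrightarrow> (\<sigma> v, \<tau> v) \<in> eq_theory \<Sigma> E W"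
  shows "(tsubst \<sigma> t, tsubst \<tau> t) \<in> eq_theory \<Sigma> E W"
  using assms by (induction t) (auto intro!: eq_theory.cong simp: list_all2_conv_all_nth)

section \<open>Filling and plugging of contexts\<close>

lemma fill_over:
  "trm_over \<Sigma> (insert None (Some ` X)) c \<Longrightarrow> trm_over \<Sigma> X t \<Longrightarrow> trm_over \<Sigma> X (fill c t)"
  unfolding fill_def by (rule trm_over_tsubst) (auto split: option.split dest: occs_subset)

text \<open>Plugging is independent of representatives: \<open>eq_theory_tsubst\<close> exchanges
  the context for a fixed plugged term, \<open>tsubst_eq_theory\<close> exchanges the plugged term
  in a fixed context, and transitivity combines the two.\<close>

lemma plug_atom_of:
  assumes c: "trm_over \<Sigma> (insert None (Some ` X)) c" and t: "trm_over \<Sigma> X t"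
  shows "plug \<Sigma> E X (atom_of \<Sigma> E (insert None (Some ` X)) c) (atom_of \<Sigma> E X t)
    = atom_of \<Sigma> E X (fill c t)"
proof -
  let ?V = "insert None (Some ` X)"
  have "atom_of \<Sigma> E X (fill c' t') = atom_of \<Sigma> E X (fill c t)"
    if c': "c' \<in> atom_of \<Sigma> E ?V c" and t': "t' \<in> atom_of \<Sigma> E X t" for c' t'
  proof -
    have cc: "(c, c') \<in> eq_theory \<Sigma> E ?V" and tt: "(t, t') \<in> eq_theory \<Sigma> E X"
      using c' t' by (simp_all add: mem_atom_of)
    have "(fill c t, fill c' t) \<in> eq_theory \<Sigma> E X"
      unfolding fill_def using cc t by (rule_tac eq_theory_tsubst) auto
    moreover have "(fill c' t, fill c' t') \<in> eq_theory \<Sigma> E X"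
      unfolding fill_def using eq_theory_over[OF cc] tt
      by (intro tsubst_eq_theory[of ?V]) (auto intro!: eq_theory.refl[of _ _ "Var _"])
    ultimately have "(fill c t, fill c' t') \<in> eq_theory \<Sigma> E X"
      by (rule eq_theory.trans)
    then show ?thesis
      using eq_theory_over by (metis atom_of_eq_iff)
  qed
  moreover have "c \<in> atom_of \<Sigma> E ?V c" "t \<in> atom_of \<Sigma> E X t"
    using c t by (auto simp: mem_atom_of intro: eq_theory.refl)
  ultimately show ?thesis
    unfolding plug_def by blast
qed

text \<open>The definition promises a single hole for some member of the class, not for the term
  \<open>t\<close> by which the quotient presents it. That member is made the
  representative.\<close>

lemma contextsE:
  assumes "C \<in> contexts \<Sigma> E X"
  obtains c where "C = atom_of \<Sigma> E (insert None (Some ` X)) c"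
    "trm_over \<Sigma> (insert None (Some ` X)) c" "count_list (occs c) None = 1"
proof -
  obtain c t where c: "c \<in> C" "count_list (occs c) None = 1"
    and C: "C = atom_of \<Sigma> E (insert None (Some ` X)) t" "trm_over \<Sigma> (insert None (Some ` X)) t"
    using assms by (auto simp: contexts_def atoms_eq)
  have "(t, c) \<in> eq_theory \<Sigma> E (insert None (Some ` X))"
    using c C by (simp add: mem_atom_of)
  then show thesis
    using that c C eq_theory_over by (metis atom_of_eq_iff)
qed

lemma contextsI:
  "trm_over \<Sigma> (insert None (Some ` X)) c \<Longrightarrow> count_list (occs c) None = 1 \<Longrightarrow>
    atom_of \<Sigma> E (insert None (Some ` X)) c \<in> contexts \<Sigma> E X"
  by (auto simp: contexts_def mem_atom_of intro!: atom_of_in_atoms bexI[of _ c] eq_theory.refl)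

lemma lang_op_subset_atoms:
  assumes "(g, length Ls) \<in> \<Sigma>" "\<forall>M\<in>set Ls. M \<subseteq> atoms \<Sigma> E X"
  shows "lang_op \<Sigma> E X g Ls \<subseteq> atoms \<Sigma> E X"
proof
  fix a assume "a \<in> lang_op \<Sigma> E X g Ls"
  then obtain as where a: "a = atom_op \<Sigma> E X g as" and as: "list_all2 (\<in>) as Ls"
    by (auto simp: lang_op_def)
  have "set as \<subseteq> atoms \<Sigma> E X"
    using as assms(2) by (fastforce simp: list_all2_conv_all_nth in_set_conv_nth)
  then obtain ts where ts: "as = map (atom_of \<Sigma> E X) ts" "\<forall>t\<in>set ts. trm_over \<Sigma> X t"
    by (rule atom_list_rep)
  moreover have "(g, length ts) \<in> \<Sigma>"
    using assms(1) as ts by (auto dest: list_all2_lengthD)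
  ultimately show "a \<in> atoms \<Sigma> E X"
    using a by (auto simp: atom_op_atom_of intro!: atom_of_in_atoms)
qed

end

lemma lang_op_mono:
  assumes "list_all2 (\<subseteq>) Ls Ms"
  shows "lang_op \<Sigma> E X g Ls \<subseteq> lang_op \<Sigma> E X g Ms"
proof -
  have "list_all2 (\<in>) as Ms" if "list_all2 (\<in>) as Ls" for as
    using that assms by (rule list_all2_trans[rotated 1]) auto
  then show ?thesis unfolding lang_op_def by blast
qed

lemma hyp_step_subsetI:
  assumes "\<And>C e f. C \<in> contexts \<Sigma> E X \<Longrightarrow> (e, f) \<in> H \<Longrightarrow>
    plug \<Sigma> E X C ` lang_of \<Sigma> E X f \<subseteq> L \<Longrightarrow> plug \<Sigma> E X C ` lang_of \<Sigma> E X e \<subseteq> M"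
  shows "hyp_step \<Sigma> E X H L \<subseteq> M"
  unfolding hyp_step_def
proof (rule Union_least)
  fix S
  assume "S \<in> {plug \<Sigma> E X C ` lang_of \<Sigma> E X e | C e f.
    C \<in> contexts \<Sigma> E X \<and> (e, f) \<in> H \<and> plug \<Sigma> E X C ` lang_of \<Sigma> E X f \<subseteq> L}"
  then obtain C e f where S: "S = plug \<Sigma> E X C ` lang_of \<Sigma> E X e"
    and "C \<in> contexts \<Sigma> E X" "(e, f) \<in> H" "plug \<Sigma> E X C ` lang_of \<Sigma> E X f \<subseteq> L"
    by (elim CollectE exE conjE)
  then show "S \<subseteq> M"
    unfolding S by (intro assms)
qed

lemma hyp_stepI:
  assumes "C \<in> contexts \<Sigma> E X" "(e, f) \<in> H" "plug \<Sigma> E X C ` lang_of \<Sigma> E X f \<subseteq> L"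
  shows "plug \<Sigma> E X C ` lang_of \<Sigma> E X e \<subseteq> hyp_step \<Sigma> E X H L"
  unfolding hyp_step_def
  by (rule Union_upper, rule CollectI, rule exI[of _ C], rule exI[of _ e], rule exI[of _ f])
    (intro conjI HOL.refl assms)

lemma hyp_step_mono: "K \<subseteq> M \<Longrightarrow> hyp_step \<Sigma> E X H K \<subseteq> hyp_step \<Sigma> E X H M"
  by (rule hyp_step_subsetI, rule hyp_stepI) (assumption | erule order_trans)+

section \<open>Lattices of sets\<close>

abbreviation set_lattice :: "('a set \<Rightarrow> bool) \<Rightarrow> 'a set gorder" where
  "set_lattice P \<equiv> \<lparr>carrier = Collect P, eq = (=), le = (\<subseteq>)\<rparr>"

text \<open>A closure system on \<open>U\<close>. Only nonempty families are intersected, since the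
  empty intersection is the whole type rather than \<open>U\<close>; \<open>top\<close> takes its
  place. The languages of atoms and the closed languages are both instances.\<close>

locale moore_family =
  fixes P :: "'a set \<Rightarrow> bool" and U :: "'a set"
  assumes top: "P U" and sub: "P S \<Longrightarrow> S \<subseteq> U"
    and Inter: "\<A> \<noteq> {} \<Longrightarrow> (\<And>S. S \<in> \<A> \<Longrightarrow> P S) \<Longrightarrow> P (\<Inter>\<A>)"
begin

lemma hull_closed: "S \<subseteq> U \<Longrightarrow> P (P hull S)"
  unfolding hull_def using top by (intro Inter) auto

lemma partial_order_set_lattice: "partial_order (set_lattice P)"
  by unfold_locales auto

lemma complete_lattice_set_lattice: "complete_lattice (set_lattice P)"
proof (rule partial_order.complete_lattice_criterion1[OF partial_order_set_lattice])
  show "\<exists>g. greatest (set_lattice P) g (carrier (set_lattice P))"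
    using top sub by (auto simp: greatest_def)
  fix \<A> assume "\<A> \<subseteq> carrier (set_lattice P)" "\<A> \<noteq> {}"
  then have "greatest (set_lattice P) (\<Inter>\<A>) (Lower (set_lattice P) \<A>)"
    by (auto simp: greatest_def Lower_def intro!: Inter)
  then show "\<exists>i. greatest (set_lattice P) i (Lower (set_lattice P) \<A>)" ..
qed

lemma sup_set_lattice:
  assumes "\<A> \<subseteq> Collect P"
  shows "\<Squnion>\<^bsub>set_lattice P\<^esub>\<A> = P hull \<Union>\<A>"
proof -
  interpret complete_lattice "set_lattice P"
    by (rule complete_lattice_set_lattice)
  have "P (P hull \<Union>\<A>)"
    using assms sub by (intro hull_closed) auto
  moreover have "P (\<Squnion>\<^bsub>set_lattice P\<^esub>\<A>)"
    using weak.sup_closed[of \<A>] assms by simp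
  moreover have "P hull \<Union>\<A> \<subseteq> \<Squnion>\<^bsub>set_lattice P\<^esub>\<A>"
    using calculation weak.sup_upper[of \<A>] assms by (intro hull_minimal) auto
  moreover have "\<Squnion>\<^bsub>set_lattice P\<^esub>\<A> \<subseteq> P hull \<Union>\<A>"
    using calculation weak.sup_least[of \<A> "P hull \<Union>\<A>"] assms hull_subset[of "\<Union>\<A>" P] by auto
  ultimately show ?thesis by blast
qed

end

lemma moore_family_Pow: "moore_family (\<lambda>S. S \<subseteq> U) U"
  by unfold_locales auto

lemma lang_lattice_eq: "lang_lattice \<Sigma> E X = set_lattice (\<lambda>S. S \<subseteq> atoms \<Sigma> E X)"
  by (simp add: lang_lattice_def Pow_def)

section \<open>Monotone algebras\<close>

text \<open>Interpreting \<open>Mu\<close> only asks for monotone operations on a complete lattice.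
  This common base serves continuous models and the language lattice alike, so the latter enters
  without a separate proof of continuity.\<close>

locale monotone_algebra = complete_lattice L for L :: "'a gorder" (structure) +
  fixes \<Sigma> :: "'f signature" and I :: "'f \<Rightarrow> 'a list \<Rightarrow> 'a"
  assumes op_closed: "(g, length as) \<in> \<Sigma> \<Longrightarrow> set as \<subseteq> carrier L \<Longrightarrow> I g as \<in> carrier L"
    and op_mono: "(g, length as) \<in> \<Sigma> \<Longrightarrow> set as \<subseteq> carrier L \<Longrightarrow> set bs \<subseteq> carrier L \<Longrightarrow>
      list_all2 (\<sqsubseteq>) as bs \<Longrightarrow> I g as \<sqsubseteq> I g bs"
begin

lemma sup_le_iff:
  assumes "A \<subseteq> carrier L" "u \<in> carrier L"
  shows "\<Squnion>A \<sqsubseteq> u \<longleftrightarrow> (\<forall>a\<in>A. a \<sqsubseteq> u)"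
  using assms by (meson le_trans subsetD weak.sup_closed weak.sup_least weak.sup_upper)

lemma teval_closed:
  "trm_over \<Sigma> V t \<Longrightarrow> (\<And>v. v \<in> V \<Longrightarrow> \<nu> v \<in> carrier L) \<Longrightarrow> teval I \<nu> t \<in> carrier L"
  by (induction t) (auto intro!: op_closed)

lemma interp_env_closed:
  assumes "expr_over \<Sigma> X e" "\<And>x. x \<in> X \<Longrightarrow> \<rho> x \<in> carrier L" "\<And>r. \<eta> r \<in> carrier L"
  shows "interp_env L I \<rho> \<eta> e \<in> carrier L"
  using assms by (induction e arbitrary: \<eta>) (auto intro!: op_closed)

text \<open>In the case of \<open>Mu\<close>, a prefixed point of the body under the larger
  environment is, by induction, one under the smaller environment, and the least fixpoints compare
  accordingly.\<close>

lemma interp_env_mono: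
  assumes "expr_over \<Sigma> X e" "\<And>x. x \<in> X \<Longrightarrow> \<rho> x \<in> carrier L"
    and "\<And>r. \<eta> r \<in> carrier L" "\<And>r. \<eta>' r \<in> carrier L" "\<And>r. \<eta> r \<sqsubseteq> \<eta>' r"
  shows "interp_env L I \<rho> \<eta> e \<sqsubseteq> interp_env L I \<rho> \<eta>' e"
  using assms
proof (induction e arbitrary: \<eta> \<eta>')
  case (EFun g es)
  then have "\<forall>e\<in>set es. interp_env L I \<rho> \<eta> e \<sqsubseteq> interp_env L I \<rho> \<eta>' e"
    by auto
  then show ?case
    using EFun.prems by (auto intro!: op_mono interp_env_closed simp: list_all2_conv_all_nth)
next
  case (Plus e f)
  then have "interp_env L I \<rho> \<eta> h \<in> carrier L" "interp_env L I \<rho> \<eta>' h \<in> carrier L"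
      "interp_env L I \<rho> \<eta> h \<sqsubseteq> interp_env L I \<rho> \<eta>' h" if "h \<in> {e, f}" for h
    using that by (auto intro!: interp_env_closed)
  moreover have "a \<squnion> b \<sqsubseteq> a' \<squnion> b'"
    if "a \<sqsubseteq> a'" "b \<sqsubseteq> b'" "a \<in> carrier L" "a' \<in> carrier L" "b \<in> carrier L" "b' \<in> carrier L"
    for a a' b b'
    using that by (meson join_closed join_le join_left join_right le_trans)
  ultimately show ?case
    by simp
next
  case (Mu r e)
  let ?f = "\<lambda>\<eta> a. interp_env L I \<rho> (\<eta>(r := a)) e"
  have closed: "?f \<eta> u \<in> carrier L" "?f \<eta>' u \<in> carrier L" if "u \<in> carrier L" for u
    using that Mu.prems by (auto intro!: interp_env_closed)
  have "LFP (?f \<eta>) \<sqsubseteq> LFP (?f \<eta>')"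
  proof (rule weak.LFP_greatest)
    fix u assume u: "u \<in> carrier L" "?f \<eta>' u \<sqsubseteq> u"
    have "?f \<eta> u \<sqsubseteq> ?f \<eta>' u"
      using u Mu.prems by (intro Mu.IH) auto
    then have "?f \<eta> u \<sqsubseteq> u"
      using u closed le_trans by blast
    then show "LFP (?f \<eta>) \<sqsubseteq> u"
      using u by (intro weak.LFP_lowerbound)
  qed simp
  then show ?case
    by simp
qed auto

lemma interp_env_Mu_unfold:
  assumes "expr_over \<Sigma> X e" "\<And>x. x \<in> X \<Longrightarrow> \<rho> x \<in> carrier L" "\<And>r. \<eta> r \<in> carrier L"
  shows "interp_env L I \<rho> (\<eta>(r := interp_env L I \<rho> \<eta> (Mu r e))) e = interp_env L I \<rho> \<eta> (Mu r e)"
proof -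
  let ?f = "\<lambda>a. interp_env L I \<rho> (\<eta>(r := a)) e"
  have "Mono ?f"
    using assms by (intro isotoneI weak_partial_order_axioms) (auto intro!: interp_env_mono)
  moreover have "?f \<in> carrier L \<rightarrow> carrier L"
    using assms by (auto intro!: interp_env_closed)
  ultimately show ?thesis
    using LFP_unfold[of ?f] by simp
qed

end

section \<open>The algebra of languages\<close>

context linear_regular_theory
begin

lemma lang_monotone_algebra: "monotone_algebra (lang_lattice \<Sigma> E X) \<Sigma> (lang_op \<Sigma> E X)"
proof -
  interpret moore_family "\<lambda>S. S \<subseteq> atoms \<Sigma> E X" "atoms \<Sigma> E X"
    by (rule moore_family_Pow)
  interpret complete_lattice "lang_lattice \<Sigma> E X"
    unfolding lang_lattice_eq by (rule complete_lattice_set_lattice)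
  show ?thesis
  proof
    fix g and Ms :: "('f, 'a) lang list"
    assume "(g, length Ms) \<in> \<Sigma>" "set Ms \<subseteq> carrier (lang_lattice \<Sigma> E X)"
    then show "lang_op \<Sigma> E X g Ms \<in> carrier (lang_lattice \<Sigma> E X)"
      using lang_op_subset_atoms[of g Ms X] by (auto simp: lang_lattice_eq)
  next
    fix g and Ms Ns :: "('f, 'a) lang list"
    assume "list_all2 (le (lang_lattice \<Sigma> E X)) Ms Ns"
    then show "lang_op \<Sigma> E X g Ms \<sqsubseteq>\<^bsub>lang_lattice \<Sigma> E X\<^esub> lang_op \<Sigma> E X g Ns"
      using lang_op_mono[of Ms Ns \<Sigma> E X g] by (simp add: lang_lattice_eq)
  qed
qed

lemma lang_sup:
  assumes "\<A> \<subseteq> Pow (atoms \<Sigma> E X)"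
  shows "\<Squnion>\<^bsub>lang_lattice \<Sigma> E X\<^esub>\<A> = \<Union>\<A>"
proof -
  interpret moore_family "\<lambda>S. S \<subseteq> atoms \<Sigma> E X" "atoms \<Sigma> E X"
    by (rule moore_family_Pow)
  have "\<Union>\<A> \<subseteq> atoms \<Sigma> E X"
    using assms by auto
  then show ?thesis
    using assms sup_set_lattice[of \<A>] unfolding lang_lattice_eq by (simp add: Pow_def hull_same)
qed

lemma lang_bottom: "\<bottom>\<^bsub>lang_lattice \<Sigma> E X\<^esub> = {}"
proof -
  interpret monotone_algebra "lang_lattice \<Sigma> E X" \<Sigma> "lang_op \<Sigma> E X"
    by (rule lang_monotone_algebra)
  show ?thesis
    using weak.weak_sup_empty lang_sup[of "{}" X] by (simp add: eq_is_equal)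
qed

lemma lang_of_subset_atoms:
  assumes "closed_expr \<Sigma> X e"
  shows "lang_of \<Sigma> E X e \<subseteq> atoms \<Sigma> E X"
proof -
  interpret monotone_algebra "lang_lattice \<Sigma> E X" \<Sigma> "lang_op \<Sigma> E X"
    by (rule lang_monotone_algebra)
  have "lang_of \<Sigma> E X e \<in> carrier (lang_lattice \<Sigma> E X)"
    using assms unfolding lang_of_def interp_def closed_expr_def
    by (intro interp_env_closed) (auto simp: lang_lattice_eq lang_bottom[unfolded lang_lattice_eq] intro!: atom_of_in_atoms)
  then show ?thesis
    by (simp add: lang_lattice_eq)
qed

end

section \<open>Continuous models\<close>

locale continuous_algebra = linear_regular_theory \<Sigma> E + complete_lattice L
  for \<Sigma> :: "'f signature" and E :: "('f, 'v) equations" and L :: "'a gorder" (structure) +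
  fixes I :: "'f \<Rightarrow> 'a list \<Rightarrow> 'a"
  assumes continuous: "continuous_model \<Sigma> E L I"
begin

text \<open>Continuity for an argument list split around the varying argument, the form in which
  inductions over argument lists proceed.\<close>

lemma op_sup:
  assumes "(g, length (ps @ qs) + 1) \<in> \<Sigma>" "set (ps @ qs) \<subseteq> carrier L" "A \<subseteq> carrier L"
  shows "I g (ps @ \<Squnion>A # qs) = \<Squnion>((\<lambda>a. I g (ps @ a # qs)) ` A)"
proof -
  let ?n = "length (ps @ qs) + 1"
  have "\<forall>as i A. length as = ?n \<and> set as \<subseteq> carrier L \<and> i < ?n \<and> A \<subseteq> carrier L \<longrightarrow>
      I g (as[i := \<Squnion>A]) = \<Squnion>((\<lambda>a. I g (as[i := a])) ` A)"
    using continuous assms(1) unfolding continuous_model_def by blast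
  \<comment> \<open>\<open>\<bottom>\<close> only fills the slot at position
    \<open>length ps\<close>; the list update overwrites it.\<close>
  from this[rule_format, of "ps @ \<bottom> # qs" "length ps" A] show ?thesis
    using assms by simp
qed

lemma equation_holds: "(l, r) \<in> E \<Longrightarrow> (\<And>v. \<nu> v \<in> carrier L) \<Longrightarrow> teval I \<nu> l = teval I \<nu> r"
  using continuous unfolding continuous_model_def by blast

lemma op_in_carrier: "(g, length as) \<in> \<Sigma> \<Longrightarrow> set as \<subseteq> carrier L \<Longrightarrow> I g as \<in> carrier L"
  using continuous unfolding continuous_model_def by blast

text \<open>Preserving the join of the pair \<open>{a, b}\<close>, which is \<open>b\<close>,
  already yields monotonicity.\<close>

lemma sup_image_mono:
  assumes mono: "\<And>A. A \<subseteq> carrier L \<Longrightarrow> k (\<Squnion>A) = \<Squnion>(k ` A)"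
    and "\<And>a. a \<in> carrier L \<Longrightarrow> k a \<in> carrier L"
    and "a \<in> carrier L" "b \<in> carrier L" "a \<sqsubseteq> b"
  shows "k a \<sqsubseteq> k b"
proof -
  have "\<Squnion>{a, b} = b"
    using assms by (intro le_antisym weak.sup_least weak.sup_upper weak.sup_closed) auto
  then have "k b = \<Squnion>(k ` {a, b})"
    using mono[of "{a, b}"] assms by simp
  then show ?thesis
    using assms weak.sup_upper[of "k ` {a, b}" "k a"] by auto
qed

text \<open>Arguments are replaced one at a time from the left, and \<open>ps\<close> collects those
  already replaced. Monotonicity in a single argument comes from \<open>op_sup\<close> through
  \<open>sup_image_mono\<close>.\<close>

lemma op_mono_suffix:
  assumes "list_all2 (\<sqsubseteq>) as bs"
    and "(g, length (ps @ as)) \<in> \<Sigma>" "set ps \<subseteq> carrier L" "set as \<subseteq> carrier L" "set bs \<subseteq> carrier L"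
  shows "I g (ps @ as) \<sqsubseteq> I g (ps @ bs)"
  using assms
proof (induction arbitrary: ps rule: list_all2_induct)
  case Nil
  then show ?case by (auto intro!: op_in_carrier)
next
  case (Cons a as b bs)
  have len: "length bs = length as"
    using Cons.hyps by (auto dest: list_all2_lengthD)
  have "I g (ps @ a # as) \<sqsubseteq> I g (ps @ b # as)"
    using Cons.prems Cons.hyps
    by (intro sup_image_mono[where k = "\<lambda>a. I g (ps @ a # as)"]) (auto intro!: op_sup op_in_carrier)
  also have "I g (ps @ b # as) \<sqsubseteq> I g (ps @ b # bs)"
    using Cons.IH[of "ps @ [b]"] Cons.prems by simp
  finally show ?case
    using Cons.prems len by (simp add: op_in_carrier)
qed

end

sublocale continuous_algebra \<subseteq> monotone_algebra L \<Sigma> I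
  using op_mono_suffix[where ps = "[]"] by unfold_locales (auto intro: op_in_carrier)

context continuous_algebra
begin

text \<open>Continuity is applied to one argument at a time, while \<open>ps\<close> collects the
  elements chosen for the earlier ones. Bounding by an arbitrary \<open>u\<close> avoids rewriting
  nested joins as one join over lists.\<close>

lemma op_map_sup_le:
  assumes "(g, length ps + length As) \<in> \<Sigma>" "set ps \<subseteq> carrier L" "\<forall>A\<in>set As. A \<subseteq> carrier L"
    and "u \<in> carrier L" "\<And>as. list_all2 (\<in>) as As \<Longrightarrow> I g (ps @ as) \<sqsubseteq> u"
  shows "I g (ps @ map (Lattice.sup L) As) \<sqsubseteq> u"
  using assms
proof (induction As arbitrary: ps)
  case Nil
  then show ?case by simp
next
  case (Cons A As)
  have "I g (ps @ a # map (Lattice.sup L) As) \<sqsubseteq> u" if "a \<in> A" for a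
    using Cons.IH[of "ps @ [a]"] Cons.prems that by auto
  moreover have "I g (ps @ a # map (Lattice.sup L) As) \<in> carrier L" if "a \<in> A" for a
    using Cons.prems that by (intro op_in_carrier) auto
  moreover have "I g (ps @ \<Squnion>A # map (Lattice.sup L) As) = \<Squnion>((\<lambda>a. I g (ps @ a # map (Lattice.sup L) As)) ` A)"
    using Cons.prems by (intro op_sup) auto
  ultimately show ?case
    using Cons.prems by (auto intro!: weak.sup_least)
qed

lemma teval_eq_theory:
  assumes "(s, t) \<in> eq_theory \<Sigma> E V" "\<And>v. v \<in> V \<Longrightarrow> \<nu> v \<in> carrier L"
  shows "teval I \<nu> s = teval I \<nu> t"
  using assms(1)
proof (induction rule: eq_theory.induct)
  case (cong g ts us)
  then have "map (teval I \<nu>) ts = map (teval I \<nu>) us"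
    by (simp add: list_all2_conv_all_nth map_equality_iff)
  then show ?case by simp
next
  case (inst l r \<sigma>)
  have "teval I \<nu> (\<sigma> v) \<in> carrier L" for v
    by (rule teval_closed[OF inst.hyps(2) assms(2)])
  with inst.hyps(1) show ?case
    by (simp add: teval_tsubst equation_holds)
qed simp_all

text \<open>The induction on \<open>c\<close> descends into the only argument that contains the hole.\<close>

lemma teval_hole_sup:
  assumes "trm_over \<Sigma> (insert None (Some ` X)) c" "count_list (occs c) None = 1"
    and "\<And>x. x \<in> X \<Longrightarrow> \<rho> x \<in> carrier L" "A \<subseteq> carrier L"
  shows "teval I (case_option (\<Squnion>A) \<rho>) c = \<Squnion>((\<lambda>a. teval I (case_option a \<rho>) c) ` A)"
  using assms
proof (induction c arbitrary: A)
  case (Var v)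
  then show ?case by (auto split: if_splits)
next
  case (Fun g ts)
  \<comment> \<open>A single hole among all arguments means that one argument has exactly one and
    the others have none.\<close>
  have "\<exists>us c vs. ts = us @ c # vs \<and> count_list (occs c) None = 1 \<and>
      (\<forall>t\<in>set (us @ vs). None \<notin> set (occs t))"
    using Fun.prems(2)
  proof (simp, induction ts)
    case (Cons t ts)
    show ?case
    proof (cases "None \<in> set (occs t)")
      case True
      then have "count_list (occs t) None = 1" "None \<notin> set (concat (map occs ts))"
        using Cons.prems count_list_0_iff[of "occs t" None]
          count_list_0_iff[of "concat (map occs ts)" None] by (auto simp del: count_list_0_iff)
      then show ?thesis
        by (intro exI[of _ "[]"] exI[of _ t] exI[of _ ts]) auto
    next
      case False
      then have "count_list (concat (map occs ts)) None = Suc 0"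
        using Cons.prems by simp
      with Cons.IH obtain us c vs where "ts = us @ c # vs" "count_list (occs c) None = 1"
        "\<forall>t\<in>set (us @ vs). None \<notin> set (occs t)"
        by auto
      with False show ?thesis
        by (intro exI[of _ "t # us"] exI[of _ c] exI[of _ vs]) auto
    qed
  qed simp
  then obtain us c vs where ts: "ts = us @ c # vs" "count_list (occs c) None = 1"
    "\<forall>t\<in>set (us @ vs). None \<notin> set (occs t)"
    by blast
  \<comment> \<open>The arguments beside the hole have the same value for every \<open>a\<close>;
    \<open>\<bottom>\<close> is an arbitrary choice that names this value.\<close>
  have const: "teval I (case_option a \<rho>) t = teval I (case_option \<bottom> \<rho>) t"
    if "t \<in> set (us @ vs)" for a t
    using that ts(3) by (intro teval_cong) (auto split: option.split)
  have closed: "teval I (case_option a \<rho>) t \<in> carrier L" if "t \<in> set ts" "a \<in> carrier L" for a t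
    using that Fun.prems by (intro teval_closed[where V = "insert None (Some ` X)"]) auto
  let ?us = "map (teval I (case_option \<bottom> \<rho>)) us" and ?vs = "map (teval I (case_option \<bottom> \<rho>)) vs"
  have eval: "teval I (case_option a \<rho>) (Fun g ts) = I g (?us @ teval I (case_option a \<rho>) c # ?vs)" for a
  proof -
    have "map (teval I (case_option a \<rho>)) us = ?us" "map (teval I (case_option a \<rho>)) vs = ?vs"
      by (auto intro: const)
    then show ?thesis
      by (simp add: ts(1) del: map_eq_conv)
  qed
  have IH: "teval I (case_option (\<Squnion>A) \<rho>) c = \<Squnion>((\<lambda>a. teval I (case_option a \<rho>) c) ` A)"
    using Fun.prems ts by (intro Fun.IH) auto
  have "I g (?us @ \<Squnion>((\<lambda>a. teval I (case_option a \<rho>) c) ` A) # ?vs)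
      = \<Squnion>((\<lambda>a. I g (?us @ a # ?vs)) ` (\<lambda>a. teval I (case_option a \<rho>) c) ` A)"
    using Fun.prems ts(1) by (intro op_sup) (auto intro!: closed)
  then show ?case
    unfolding eval IH by (simp add: image_image)
qed

end

section \<open>The Galois connection between languages and a continuous model\<close>

locale valued_algebra = continuous_algebra \<Sigma> E L I
  for \<Sigma> :: "'f signature" and E :: "('f, 'v) equations" and L :: "'a gorder" (structure)
    and I :: "'f \<Rightarrow> 'a list \<Rightarrow> 'a" +
  fixes X :: "'x set" and \<rho> :: "'x \<Rightarrow> 'a"
  assumes valuation: "x \<in> X \<Longrightarrow> \<rho> x \<in> carrier L"
begin

text \<open>The join ranges over terms instead of atoms, so no representative has to be chosen; by
  \<open>term_eq\<close>, terms of the same atom contribute the same value.\<close>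

definition lift :: "('f, 'x) lang \<Rightarrow> 'a" where
  "lift M = \<Squnion>{teval I \<rho> t | t. trm_over \<Sigma> X t \<and> atom_of \<Sigma> E X t \<in> M}"

definition below :: "'a \<Rightarrow> ('f, 'x) lang" where
  "below u = atom_of \<Sigma> E X ` {t. trm_over \<Sigma> X t \<and> teval I \<rho> t \<sqsubseteq> u}"

lemma term_closed: "trm_over \<Sigma> X t \<Longrightarrow> teval I \<rho> t \<in> carrier L"
  by (rule teval_closed[OF _ valuation])

lemma term_eq: "(s, t) \<in> eq_theory \<Sigma> E X \<Longrightarrow> teval I \<rho> s = teval I \<rho> t"
  by (rule teval_eq_theory[OF _ valuation])

lemma atom_of_in_below: "trm_over \<Sigma> X t \<Longrightarrow> atom_of \<Sigma> E X t \<in> below u \<longleftrightarrow> teval I \<rho> t \<sqsubseteq> u"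
  unfolding below_def using term_eq by (auto simp: atom_of_eq_iff)

lemma below_subset: "below u \<subseteq> atoms \<Sigma> E X"
  by (auto simp: below_def intro: atom_of_in_atoms)

lemma lift_closed: "lift M \<in> carrier L"
  unfolding lift_def by (rule weak.sup_closed) (auto intro: term_closed)

text \<open>The adjunction turns upper bounds on \<open>lift\<close> into inclusions of languages.
  This is how joins, operations and fixpoints of the two sides are compared.\<close>

lemma lift_le_iff:
  assumes "u \<in> carrier L" "M \<subseteq> atoms \<Sigma> E X"
  shows "lift M \<sqsubseteq> u \<longleftrightarrow> M \<subseteq> below u"
proof
  assume le: "lift M \<sqsubseteq> u"
  show "M \<subseteq> below u"
  proof
    fix a assume a: "a \<in> M"
    then obtain t where t: "a = atom_of \<Sigma> E X t" "trm_over \<Sigma> X t"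
      using assms by (auto simp: atoms_eq)
    then have "teval I \<rho> t \<sqsubseteq> lift M"
      unfolding lift_def using a by (intro weak.sup_upper) (auto intro: term_closed)
    with le have "teval I \<rho> t \<sqsubseteq> u"
      using t assms lift_closed term_closed le_trans by blast
    with t show "a \<in> below u"
      by (simp add: atom_of_in_below)
  qed
next
  assume "M \<subseteq> below u"
  then show "lift M \<sqsubseteq> u"
    unfolding lift_def using assms by (intro weak.sup_least) (auto simp: atom_of_in_below intro: term_closed)
qed

lemma lift_mono: "M \<subseteq> N \<Longrightarrow> N \<subseteq> atoms \<Sigma> E X \<Longrightarrow> lift M \<sqsubseteq> lift N"
  by (meson lift_le_iff lift_closed le_refl order_trans)

lemma teval_le_lift:
  "M \<subseteq> atoms \<Sigma> E X \<Longrightarrow> trm_over \<Sigma> X t \<Longrightarrow> atom_of \<Sigma> E X t \<in> M \<Longrightarrow> teval I \<rho> t \<sqsubseteq> lift M"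
  unfolding lift_def by (intro weak.sup_upper) (auto intro: term_closed)

text \<open>One inequality is monotonicity, as the value of every argument term lies below the
  \<open>lift\<close> of its language. For the other, every \<open>lift\<close> is expanded as a
  join of term values: by \<open>op_map_sup_le\<close> it suffices to treat one choice of values,
  and applying \<open>g\<close> to that choice gives the value of a term whose atom is in the
  language.\<close>

lemma lift_lang_op:
  assumes sig: "(g, length Ms) \<in> \<Sigma>" and Ms: "\<forall>M\<in>set Ms. M \<subseteq> atoms \<Sigma> E X"
  shows "lift (lang_op \<Sigma> E X g Ms) = I g (map lift Ms)"
proof (rule le_antisym)
  let ?T = "\<lambda>M. {teval I \<rho> t | t. trm_over \<Sigma> X t \<and> atom_of \<Sigma> E X t \<in> M}"
  show closed: "I g (map lift Ms) \<in> carrier L"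
    using sig by (auto intro!: op_in_carrier lift_closed)
  have sub: "lang_op \<Sigma> E X g Ms \<subseteq> atoms \<Sigma> E X"
    using sig Ms by (rule lang_op_subset_atoms)
  have rep: "\<exists>ts. as = map (atom_of \<Sigma> E X) ts \<and> (\<forall>t\<in>set ts. trm_over \<Sigma> X t)"
    if "list_all2 (\<in>) as Ms" for as
  proof -
    have "set as \<subseteq> atoms \<Sigma> E X"
      using that Ms by (fastforce simp: list_all2_conv_all_nth in_set_conv_nth)
    then show ?thesis
      by (rule atom_list_rep) blast
  qed
  have "a \<in> below (I g (map lift Ms))" if a_in: "a \<in> lang_op \<Sigma> E X g Ms" for a
  proof -
    obtain as where a: "a = atom_op \<Sigma> E X g as" and as: "list_all2 (\<in>) as Ms"
      using a_in unfolding lang_op_def by blast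
    from rep[OF as] obtain ts where ts: "as = map (atom_of \<Sigma> E X) ts" "\<forall>t\<in>set ts. trm_over \<Sigma> X t"
      by blast
    have len: "length ts = length Ms"
      using as ts by (auto dest: list_all2_lengthD)
    have "teval I \<rho> (ts ! i) \<sqsubseteq> lift (Ms ! i)" if i: "i < length Ms" for i
    proof (rule teval_le_lift)
      show "Ms ! i \<subseteq> atoms \<Sigma> E X" "trm_over \<Sigma> X (ts ! i)" "atom_of \<Sigma> E X (ts ! i) \<in> Ms ! i"
        using i Ms as ts len by (auto simp: list_all2_conv_all_nth)
    qed
    then have "list_all2 (\<sqsubseteq>) (map (teval I \<rho>) ts) (map lift Ms)"
      using len by (simp add: list_all2_conv_all_nth)
    then have "I g (map (teval I \<rho>) ts) \<sqsubseteq> I g (map lift Ms)"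
      using sig len ts(2) by (intro op_mono) (auto intro: term_closed lift_closed)
    then show ?thesis
      using sig a ts len by (simp add: atom_op_atom_of atom_of_in_below)
  qed
  then show "lift (lang_op \<Sigma> E X g Ms) \<sqsubseteq> I g (map lift Ms)"
    unfolding lift_le_iff[OF closed sub] by (rule subsetI)
  have "I g as \<sqsubseteq> lift (lang_op \<Sigma> E X g Ms)" if as: "list_all2 (\<in>) as (map ?T Ms)" for as
  proof -
    have "\<forall>i<length Ms. \<exists>t. as ! i = teval I \<rho> t \<and> trm_over \<Sigma> X t \<and> atom_of \<Sigma> E X t \<in> Ms ! i"
      using as by (auto simp: list_all2_conv_all_nth)
    then obtain \<tau> where \<tau>: "\<And>i. i < length Ms \<Longrightarrow>
        as ! i = teval I \<rho> (\<tau> i) \<and> trm_over \<Sigma> X (\<tau> i) \<and> atom_of \<Sigma> E X (\<tau> i) \<in> Ms ! i"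
      by (auto simp: choice_iff')
    let ?ts = "map \<tau> [0..<length Ms]"
    have "as = map (teval I \<rho>) ?ts"
      using as \<tau> by (intro nth_equalityI) (simp_all add: list_all2_conv_all_nth)
    moreover have "list_all2 (\<in>) (map (atom_of \<Sigma> E X) ?ts) Ms"
      using \<tau> by (auto simp: list_all2_conv_all_nth)
    then have "atom_op \<Sigma> E X g (map (atom_of \<Sigma> E X) ?ts) \<in> lang_op \<Sigma> E X g Ms"
      unfolding lang_op_def by blast
    moreover have "atom_op \<Sigma> E X g (map (atom_of \<Sigma> E X) ?ts) = atom_of \<Sigma> E X (Fun g ?ts)"
      using sig \<tau> by (intro atom_op_atom_of) auto
    ultimately have "atom_of \<Sigma> E X (Fun g ?ts) \<in> lang_op \<Sigma> E X g Ms" "as = map (teval I \<rho>) ?ts"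
      by (simp_all only:)
    moreover have "trm_over \<Sigma> X (Fun g ?ts)"
      using sig \<tau> by auto
    ultimately show ?thesis
      using teval_le_lift[OF sub, of "Fun g ?ts"] by (simp only: teval.simps)
  qed
  then have "I g ([] @ map (Lattice.sup L) (map ?T Ms)) \<sqsubseteq> lift (lang_op \<Sigma> E X g Ms)"
    using sig by (intro op_map_sup_le) (auto intro: term_closed lift_closed)
  moreover have "map (Lattice.sup L) (map ?T Ms) = map lift Ms"
    by (simp add: lift_def)
  ultimately show "I g (map lift Ms) \<sqsubseteq> lift (lang_op \<Sigma> E X g Ms)"
    by (simp only: append_Nil)
qed (rule lift_closed)

text \<open>All cases but \<open>Mu\<close> follow from \<open>lift\<close> preserving operations
  and joins. For \<open>Mu\<close>, the induction hypothesis says that \<open>lift\<close>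
  intertwines the two bodies, so it sends the least fixpoint over languages to a fixpoint in
  \<open>L\<close>; that this fixpoint is the least one needs the adjoint.\<close>

lemma lift_interp_env:
  assumes "expr_over \<Sigma> X e" "\<And>r. \<eta> r \<subseteq> atoms \<Sigma> E X"
  shows "lift (interp_env (lang_lattice \<Sigma> E X) (lang_op \<Sigma> E X) (\<lambda>x. {atom_of \<Sigma> E X (Var x)}) \<eta> e)
    = interp_env L I \<rho> (\<lambda>r. lift (\<eta> r)) e"
proof -
  interpret lang: monotone_algebra "lang_lattice \<Sigma> E X" \<Sigma> "lang_op \<Sigma> E X"
    by (rule lang_monotone_algebra)
  let ?i = "interp_env (lang_lattice \<Sigma> E X) (lang_op \<Sigma> E X) (\<lambda>x. {atom_of \<Sigma> E X (Var x)})"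
  have sub: "?i \<eta> e \<subseteq> atoms \<Sigma> E X" if "expr_over \<Sigma> X e" "\<And>r. \<eta> r \<subseteq> atoms \<Sigma> E X" for \<eta> e
  proof -
    have "?i \<eta> e \<in> carrier (lang_lattice \<Sigma> E X)"
      using that by (intro lang.interp_env_closed) (auto simp: lang_lattice_eq intro!: atom_of_in_atoms)
    then show ?thesis
      by (simp add: lang_lattice_eq)
  qed
  show ?thesis
    using assms
  proof (induction e arbitrary: \<eta>)
    case (EVar x)
    then have t: "trm_over \<Sigma> X (Var x)"
      by simp
    have "lift {atom_of \<Sigma> E X (Var x)} = teval I \<rho> (Var x)"
    proof (intro le_antisym lift_closed term_closed t)
      show "lift {atom_of \<Sigma> E X (Var x)} \<sqsubseteq> teval I \<rho> (Var x)"
        using le_refl[OF term_closed[OF t]] atom_of_in_atoms[OF t] term_closed[OF t]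
        by (simp only: lift_le_iff atom_of_in_below[OF t] insert_subset empty_subsetI simp_thms)
      show "teval I \<rho> (Var x) \<sqsubseteq> lift {atom_of \<Sigma> E X (Var x)}"
        using t atom_of_in_atoms[OF t] by (rule_tac teval_le_lift) simp_all
    qed
    then show ?case by simp
  next
    case (RVar r)
    then show ?case by simp
  next
    case (EFun g es)
    have "map (\<lambda>e. lift (?i \<eta> e)) es = map (interp_env L I \<rho> (\<lambda>r. lift (\<eta> r))) es"
      using EFun by auto
    moreover have "lift (lang_op \<Sigma> E X g (map (?i \<eta>) es)) = I g (map lift (map (?i \<eta>) es))"
      using EFun.prems sub by (intro lift_lang_op) auto
    ultimately show ?case
      by (simp add: comp_def del: map_eq_conv)
  next
    case Zero
    show ?case
      using weak.weak_sup_empty by (simp add: lang_bottom lift_def eq_is_equal)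
  next
    case (Plus e f)
    have sub': "?i \<eta> e \<subseteq> atoms \<Sigma> E X" "?i \<eta> f \<subseteq> atoms \<Sigma> E X"
      using Plus.prems by (simp_all add: sub)
    then have "?i \<eta> (Plus e f) = ?i \<eta> e \<union> ?i \<eta> f"
      by (simp add: join_def lang_sup)
    moreover have "lift (?i \<eta> e \<union> ?i \<eta> f) = lift (?i \<eta> e) \<squnion> lift (?i \<eta> f)"
    proof (rule le_antisym)
      have "?i \<eta> e \<subseteq> below (lift (?i \<eta> e) \<squnion> lift (?i \<eta> f))"
        "?i \<eta> f \<subseteq> below (lift (?i \<eta> e) \<squnion> lift (?i \<eta> f))"
        using sub' by (auto simp: lift_le_iff[symmetric] lift_closed intro: join_left join_right)
      then show "lift (?i \<eta> e \<union> ?i \<eta> f) \<sqsubseteq> lift (?i \<eta> e) \<squnion> lift (?i \<eta> f)"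
        using sub' by (simp add: lift_le_iff lift_closed)
    qed (use sub' in \<open>auto intro!: join_le lift_mono lift_closed join_closed\<close>)
    ultimately show ?case
      using Plus by simp
  next
    case (Mu r e)
    let ?\<eta> = "\<lambda>r. lift (\<eta> r)"
    let ?F = "\<lambda>a. interp_env L I \<rho> (?\<eta>(r := a)) e" and ?G = "\<lambda>M. ?i (\<eta>(r := M)) e"
    have IH: "lift (?G M) = ?F (lift M)" if "M \<subseteq> atoms \<Sigma> E X" for M
    proof -
      have "lift (?G M) = interp_env L I \<rho> (\<lambda>r'. lift ((\<eta>(r := M)) r')) e"
        using that Mu.prems by (intro Mu.IH) auto
      also have "(\<lambda>r'. lift ((\<eta>(r := M)) r')) = ?\<eta>(r := lift M)"
        by auto
      finally show ?thesis .
    qed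
    have subG: "?G M \<subseteq> atoms \<Sigma> E X" if "M \<subseteq> atoms \<Sigma> E X" for M
      using that Mu.prems by (intro sub) auto
    have F_closed: "?F a \<in> carrier L" if "a \<in> carrier L" for a
      using that Mu.prems by (intro interp_env_closed) (auto intro: valuation lift_closed)
    define N where "N = LFP\<^bsub>lang_lattice \<Sigma> E X\<^esub> ?G"
    have N: "N \<subseteq> atoms \<Sigma> E X"
      using lang.weak.LFP_closed[of ?G] by (simp add: N_def lang_lattice_eq)
    have "?G N = N"
      using lang.interp_env_Mu_unfold[of X e "\<lambda>x. {atom_of \<Sigma> E X (Var x)}" \<eta> r] Mu.prems
      by (simp add: N_def lang_lattice_eq atom_of_in_atoms)
    then have "?F (lift N) = lift N"
      using IH[OF N] by simp
    then have 1: "LFP ?F \<sqsubseteq> lift N"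
      by (intro weak.LFP_lowerbound lift_closed) (simp add: lift_closed)
    \<comment> \<open>For a prefixed point \<open>u\<close> of \<open>?F\<close>, the language
      \<open>below u\<close> is a prefixed point of \<open>?G\<close>:
      \<open>?F (lift (below u)) \<sqsubseteq> ?F u \<sqsubseteq> u\<close>, and the adjunction
      moves \<open>lift\<close> across.\<close>
    have 2: "lift N \<sqsubseteq> LFP ?F"
    proof (rule weak.LFP_greatest[OF lift_closed])
      fix u assume u: "u \<in> carrier L" "?F u \<sqsubseteq> u"
      have "lift (below u) \<sqsubseteq> u"
        using u below_subset by (simp add: lift_le_iff)
      then have "?F (lift (below u)) \<sqsubseteq> ?F u"
        using Mu.prems u by (intro interp_env_mono) (auto intro: valuation lift_closed)
      then have "?F (lift (below u)) \<sqsubseteq> u"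
        by (rule le_trans[OF _ u(2)]) (use u in \<open>simp_all add: F_closed lift_closed\<close>)
      then have "?G (below u) \<subseteq> below u"
        using u subG[OF below_subset] by (simp add: IH[OF below_subset, symmetric] lift_le_iff)
      then have "N \<subseteq> below u"
        using lang.weak.LFP_lowerbound[of "below u" ?G] below_subset by (simp add: N_def lang_lattice_eq)
      then show "lift N \<sqsubseteq> u"
        using u N by (simp add: lift_le_iff)
    qed
    show ?case
      using le_antisym[OF 2 1] by (simp add: N_def lift_closed)
  qed
qed

lemma lift_lang_of:
  assumes "closed_expr \<Sigma> X e"
  shows "lift (lang_of \<Sigma> E X e) = interp L I \<rho> e"
proof -
  \<comment> \<open>This makes the initial environments of the two interpretations correspond, since
    the bottom language is empty.\<close>
  have "lift {} = \<bottom>"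
    using weak.weak_sup_empty by (simp add: lift_def eq_is_equal)
  then show ?thesis
    using assms lift_interp_env[of e "\<lambda>_. {}"]
    by (simp add: lang_of_def interp_def closed_expr_def lang_bottom)
qed

text \<open>\<open>lift M\<close> is a join of term values and the one-hole term \<open>c\<close>
  preserves it, so the right-hand side says that each single plugged term has a value below
  \<open>u\<close>. An inclusion about a context thus becomes an inequality in the model.\<close>

lemma plug_subset_below_iff:
  assumes c: "trm_over \<Sigma> (insert None (Some ` X)) c" "count_list (occs c) None = 1"
    and M: "M \<subseteq> atoms \<Sigma> E X" and u: "u \<in> carrier L"
  shows "plug \<Sigma> E X (atom_of \<Sigma> E (insert None (Some ` X)) c) ` M \<subseteq> below u
    \<longleftrightarrow> teval I (case_option (lift M) \<rho>) c \<sqsubseteq> u"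
proof -
  let ?k = "\<lambda>a. teval I (case_option a \<rho>) c"
  let ?T = "{t. trm_over \<Sigma> X t \<and> atom_of \<Sigma> E X t \<in> M}"
  have fill: "teval I \<rho> (fill c t) = ?k (teval I \<rho> t)" for t
    unfolding fill_def teval_tsubst by (rule teval_cong) (simp split: option.split)
  have closed: "?k a \<in> carrier L" if "a \<in> carrier L" for a
    by (rule teval_closed[OF c(1)]) (use that in \<open>auto intro: valuation\<close>)
  have "lift M = \<Squnion>(teval I \<rho> ` ?T)"
    unfolding lift_def by (rule arg_cong[where f = "Lattice.sup L"]) auto
  moreover have "?k (\<Squnion>(teval I \<rho> ` ?T)) = \<Squnion>(?k ` teval I \<rho> ` ?T)"
    by (rule teval_hole_sup[OF c valuation]) (auto intro: term_closed)
  ultimately have "?k (lift M) = \<Squnion>(?k ` teval I \<rho> ` ?T)"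
    by (simp only:)
  also have "\<dots> \<sqsubseteq> u \<longleftrightarrow> (\<forall>t\<in>?T. ?k (teval I \<rho> t) \<sqsubseteq> u)"
    using u by (subst sup_le_iff) (auto intro!: closed term_closed)
  also have "\<dots> \<longleftrightarrow> (\<forall>t\<in>?T. plug \<Sigma> E X (atom_of \<Sigma> E (insert None (Some ` X)) c)
      (atom_of \<Sigma> E X t) \<in> below u)"
    using c by (auto simp: plug_atom_of atom_of_in_below fill_over fill)
  also have "\<dots> \<longleftrightarrow> plug \<Sigma> E X (atom_of \<Sigma> E (insert None (Some ` X)) c) ` M \<subseteq> below u"
    using M by (auto simp: atoms_eq)
  finally show ?thesis by simp
qed

text \<open>By \<open>plug_subset_below_iff\<close>, the premise and the conclusion of a hypothesis
  step bound the values of the context at the \<open>lift\<close> of the two languages. The context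
  is monotone in its hole, so the bound passes from \<open>f\<close> to \<open>e\<close>.\<close>

lemma hyp_closed_below:
  assumes H: "\<And>e f. (e, f) \<in> H \<Longrightarrow>
      closed_expr \<Sigma> X e \<and> closed_expr \<Sigma> X f \<and> interp L I \<rho> e \<sqsubseteq> interp L I \<rho> f"
    and u: "u \<in> carrier L"
  shows "hyp_closed \<Sigma> E X H (below u)"
proof -
  have "plug \<Sigma> E X C ` lang_of \<Sigma> E X e \<subseteq> below u"
    if ctx: "C \<in> contexts \<Sigma> E X" and hyp: "(e, f) \<in> H"
      and sub: "plug \<Sigma> E X C ` lang_of \<Sigma> E X f \<subseteq> below u" for C e f
  proof -
    obtain c where C: "C = atom_of \<Sigma> E (insert None (Some ` X)) c"
      and c: "trm_over \<Sigma> (insert None (Some ` X)) c" "count_list (occs c) None = 1"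
      using ctx by (rule contextsE)
    let ?k = "\<lambda>a. teval I (case_option a \<rho>) c"
    have closed: "?k a \<in> carrier L" if "a \<in> carrier L" for a
      by (rule teval_closed[OF c(1)]) (use that in \<open>auto intro: valuation\<close>)
    have ef: "lift (lang_of \<Sigma> E X e) \<sqsubseteq> lift (lang_of \<Sigma> E X f)"
        "lang_of \<Sigma> E X e \<subseteq> atoms \<Sigma> E X" "lang_of \<Sigma> E X f \<subseteq> atoms \<Sigma> E X"
      using H[OF hyp] by (simp_all add: lift_lang_of lang_of_subset_atoms)
    have "?k (lift (lang_of \<Sigma> E X e)) \<sqsubseteq> ?k (lift (lang_of \<Sigma> E X f))"
    proof (rule sup_image_mono[where k = ?k])
      show "?k (\<Squnion>A) = \<Squnion>(?k ` A)" if "A \<subseteq> carrier L" for A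
        using valuation that by (rule teval_hole_sup[OF c])
    qed (use ef(1) in \<open>simp_all add: closed lift_closed\<close>)
    also have "?k (lift (lang_of \<Sigma> E X f)) \<sqsubseteq> u"
      using sub ef(3) u c by (simp add: C plug_subset_below_iff)
    finally show ?thesis
      using ef(2) u c closed lift_closed by (simp add: C plug_subset_below_iff)
  qed
  then have "hyp_step \<Sigma> E X H (below u) \<subseteq> below u"
    by (rule hyp_step_subsetI)
  then show ?thesis
    by (simp add: hyp_closed_def below_subset)
qed

end

section \<open>Soundness in every continuous model\<close>

lemma hyp_closure_imp_entails:
  fixes \<Sigma> :: "'f signature" and X :: "'x set" and E :: "('f, 'v) equations"
    and H :: "('f, 'x) inequations"
  assumes "linear_regular \<Sigma> E"
    and H: "\<forall>(e', f')\<in>H. closed_expr \<Sigma> X e' \<and> closed_expr \<Sigma> X f'"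
    and e: "closed_expr \<Sigma> X e" and f: "closed_expr \<Sigma> X f"
    and le: "hyp_closure \<Sigma> E X H (lang_of \<Sigma> E X e) \<subseteq> hyp_closure \<Sigma> E X H (lang_of \<Sigma> E X f)"
  shows "entails TYPE('a) \<Sigma> X E H e f"
  unfolding entails_def
proof (intro allI impI)
  fix L :: "'a gorder" and I \<rho>
  assume model: "continuous_model \<Sigma> E L I" and \<rho>: "\<forall>x\<in>X. \<rho> x \<in> carrier L"
    and hyps: "\<forall>(e', f')\<in>H. interp L I \<rho> e' \<sqsubseteq>\<^bsub>L\<^esub> interp L I \<rho> f'"
  interpret linear_regular_theory \<Sigma> E
    by standard fact
  interpret complete_lattice L
    using model by (simp add: continuous_model_def)
  interpret valued_algebra \<Sigma> E L I X \<rho>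
    using model \<rho> by unfold_locales auto
  \<comment> \<open>The language \<open>below ?u\<close> is closed and contains the language of
    \<open>f\<close>, hence its closure, hence by \<open>le\<close> the language of
    \<open>e\<close>; the adjunction reads this back as an inequality.\<close>
  let ?u = "interp L I \<rho> f"
  have u: "?u \<in> carrier L"
    using lift_lang_of[OF f] lift_closed by metis
  have "lang_of \<Sigma> E X f \<subseteq> below ?u"
    using u lang_of_subset_atoms[OF f] lift_lang_of[OF f] by (simp add: lift_le_iff[symmetric])
  moreover have "hyp_closed \<Sigma> E X H (below ?u)"
    using H hyps u by (intro hyp_closed_below) auto
  ultimately have "hyp_closure \<Sigma> E X H (lang_of \<Sigma> E X f) \<subseteq> below ?u"
    unfolding hyp_closure_def by (rule hull_minimal)
  moreover have "lang_of \<Sigma> E X e \<subseteq> hyp_closure \<Sigma> E X H (lang_of \<Sigma> E X e)"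
    unfolding hyp_closure_def by (rule hull_subset)
  ultimately have "lang_of \<Sigma> E X e \<subseteq> below ?u"
    using le by blast
  then show "interp L I \<rho> e \<sqsubseteq>\<^bsub>L\<^esub> ?u"
    using u lang_of_subset_atoms[OF e] lift_lang_of[OF e] by (simp add: lift_le_iff[symmetric])
qed

section \<open>The model of \<open>H\<close>-closed languages\<close>

lemma list_all2_mem_append3:
  "list_all2 (\<in>) as (Ls @ M # Ns) \<longleftrightarrow>
    (\<exists>bs a cs. as = bs @ a # cs \<and> list_all2 (\<in>) bs Ls \<and> a \<in> M \<and> list_all2 (\<in>) cs Ns)" (is "?L \<longleftrightarrow> ?R")
proof
  show "?L \<Longrightarrow> ?R"
    by (auto simp: list_all2_append2 list_all2_Cons2)
  show "?R \<Longrightarrow> ?L"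
    by (auto intro!: list_all2_appendI)
qed

lemma list_all2_mem_subset:
  "list_all2 (\<in>) as Ls \<Longrightarrow> \<forall>M\<in>set Ls. M \<subseteq> U \<Longrightarrow> set as \<subseteq> U"
  by (induction rule: list_all2_induct) auto

section \<open>Equations between languages\<close>

context linear_regular_theory
begin

lemma teval_lang_op_subset:
  assumes "trm_over \<Sigma> V t" "\<And>v. \<nu> v \<subseteq> atoms \<Sigma> E X"
  shows "teval (lang_op \<Sigma> E X) \<nu> t \<subseteq> atoms \<Sigma> E X"
  using assms(1)
proof (induction t)
  case (Fun g ts)
  then show ?case
    using lang_op_subset_atoms[of g "map (teval (lang_op \<Sigma> E X) \<nu>) ts" X] by simp
qed (simp add: assms(2))

text \<open>
  Linearity lets the substitutions for the arguments of a symbol be merged into one, so that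
  the value of a linear term at a language valuation consists of substitution instances.
\<close>

lemma merge_substitutions:
  assumes "list_all2 (\<lambda>a t. \<exists>\<sigma>. (\<forall>v\<in>set (occs t). Q v (\<sigma> v)) \<and> a = F (tsubst \<sigma> t)) as ts"
    and "distinct (concat (map occs ts))"
  shows "\<exists>\<sigma>. (\<forall>t\<in>set ts. \<forall>v\<in>set (occs t). Q v (\<sigma> v)) \<and> as = map (\<lambda>t. F (tsubst \<sigma> t)) ts"
  using assms
proof (induction rule: list_all2_induct)
  case Nil
  then show ?case by simp
next
  case (Cons a as t ts)
  then obtain \<sigma> \<tau> where \<sigma>: "\<forall>v\<in>set (occs t). Q v (\<sigma> v)" "a = F (tsubst \<sigma> t)"
    and \<tau>: "\<forall>t\<in>set ts. \<forall>v\<in>set (occs t). Q v (\<tau> v)" "as = map (\<lambda>t. F (tsubst \<tau> t)) ts"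
    by auto
  \<comment> \<open>The variables of \<open>t\<close> are disjoint from those of \<open>ts\<close>,
    so gluing changes neither family of instances.\<close>
  let ?\<sigma> = "\<lambda>v. if v \<in> set (occs t) then \<sigma> v else \<tau> v"
  have disj: "v \<notin> set (occs t)" if "u \<in> set ts" "v \<in> set (occs u)" for u v
    using that Cons.prems by auto
  have "tsubst ?\<sigma> t = tsubst \<sigma> t"
    by (rule tsubst_cong) simp
  moreover have "tsubst ?\<sigma> u = tsubst \<tau> u" if "u \<in> set ts" for u
    using disj[OF that] by (intro tsubst_cong) simp
  ultimately show ?case
    using \<sigma> \<tau> disj by (intro exI[of _ ?\<sigma>]) auto
qed

text \<open>The right-hand side substitutes the same term at all occurrences of a variable, whereas
  evaluation lets each occurrence choose its own atom. In a linear term there is no second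
  occurrence, and \<open>merge_substitutions\<close> joins the choices of the arguments.\<close>

lemma teval_lang_op_linear:
  assumes "trm_over \<Sigma> V t" "distinct (occs t)" "\<And>v. \<nu> v \<subseteq> atoms \<Sigma> E X"
  shows "teval (lang_op \<Sigma> E X) \<nu> t = {atom_of \<Sigma> E X (tsubst \<sigma> t) | \<sigma>.
    \<forall>v\<in>set (occs t). trm_over \<Sigma> X (\<sigma> v) \<and> atom_of \<Sigma> E X (\<sigma> v) \<in> \<nu> v}"
  using assms
proof (induction t)
  case (Var v)
  show ?case
  proof (intro equalityI subsetI)
    fix a assume "a \<in> teval (lang_op \<Sigma> E X) \<nu> (Var v)"
    then have a: "a \<in> \<nu> v"
      by simp
    then obtain t where "trm_over \<Sigma> X t" "a = atom_of \<Sigma> E X t"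
      using Var.prems(3)[of v] by (auto simp: atoms_eq)
    then show "a \<in> {atom_of \<Sigma> E X (tsubst \<sigma> (Var v)) | \<sigma>.
        \<forall>w\<in>set (occs (Var v)). trm_over \<Sigma> X (\<sigma> w) \<and> atom_of \<Sigma> E X (\<sigma> w) \<in> \<nu> w}"
      using a by (auto intro!: exI[of _ "\<lambda>_. t"])
  qed auto
next
  case (Fun g ts)
  let ?Q = "\<lambda>v s. trm_over \<Sigma> X s \<and> atom_of \<Sigma> E X s \<in> \<nu> v"
  have IH: "teval (lang_op \<Sigma> E X) \<nu> t =
      {atom_of \<Sigma> E X (tsubst \<sigma> t) | \<sigma>. \<forall>v\<in>set (occs t). ?Q v (\<sigma> v)}" if "t \<in> set ts" for t
    using that Fun.prems by (intro Fun.IH) (auto dest: distinct_concat simp: distinct_concat_iff)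
  have op: "atom_op \<Sigma> E X g (map (\<lambda>t. atom_of \<Sigma> E X (tsubst \<sigma> t)) ts) = atom_of \<Sigma> E X (tsubst \<sigma> (Fun g ts))"
    if "\<forall>t\<in>set ts. \<forall>v\<in>set (occs t). ?Q v (\<sigma> v)" for \<sigma>
    using atom_op_atom_of[of g "map (tsubst \<sigma>) ts" X] Fun.prems(1) that
    by (auto simp: comp_def intro!: trm_over_tsubst)
  show ?case
  proof (intro equalityI subsetI)
    fix a assume "a \<in> teval (lang_op \<Sigma> E X) \<nu> (Fun g ts)"
    then obtain as where a: "a = atom_op \<Sigma> E X g as"
      and as: "list_all2 (\<in>) as (map (teval (lang_op \<Sigma> E X) \<nu>) ts)"
      unfolding teval.simps lang_op_def by blast
    have "list_all2 (\<lambda>a t. \<exists>\<sigma>. (\<forall>v\<in>set (occs t). ?Q v (\<sigma> v)) \<and> a = atom_of \<Sigma> E X (tsubst \<sigma> t)) as ts"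
      unfolding list_all2_conv_all_nth
    proof (intro conjI allI impI)
      show len: "length as = length ts"
        using as by (auto dest: list_all2_lengthD)
      fix i assume i: "i < length as"
      then have "as ! i \<in> teval (lang_op \<Sigma> E X) \<nu> (ts ! i)"
        using as len by (auto simp: list_all2_conv_all_nth)
      then show "\<exists>\<sigma>. (\<forall>v\<in>set (occs (ts ! i)). ?Q v (\<sigma> v)) \<and> as ! i = atom_of \<Sigma> E X (tsubst \<sigma> (ts ! i))"
        using IH[of "ts ! i"] i len by auto
    qed
    moreover have "distinct (concat (map occs ts))"
      using Fun.prems(2) by simp
    ultimately have "\<exists>\<sigma>. (\<forall>t\<in>set ts. \<forall>v\<in>set (occs t). ?Q v (\<sigma> v)) \<and>
        as = map (\<lambda>t. atom_of \<Sigma> E X (tsubst \<sigma> t)) ts"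
      by (rule merge_substitutions[where Q = ?Q and F = "atom_of \<Sigma> E X"])
    then obtain \<sigma> where "\<forall>t\<in>set ts. \<forall>v\<in>set (occs t). ?Q v (\<sigma> v)"
      "as = map (\<lambda>t. atom_of \<Sigma> E X (tsubst \<sigma> t)) ts"
      by blast
    then show "a \<in> {atom_of \<Sigma> E X (tsubst \<sigma> (Fun g ts)) | \<sigma>. \<forall>v\<in>set (occs (Fun g ts)). ?Q v (\<sigma> v)}"
      using op[of \<sigma>] a by auto
  next
    fix a assume "a \<in> {atom_of \<Sigma> E X (tsubst \<sigma> (Fun g ts)) | \<sigma>. \<forall>v\<in>set (occs (Fun g ts)). ?Q v (\<sigma> v)}"
    then obtain \<sigma> where \<sigma>: "\<forall>t\<in>set ts. \<forall>v\<in>set (occs t). ?Q v (\<sigma> v)"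
      and a: "a = atom_of \<Sigma> E X (tsubst \<sigma> (Fun g ts))"
      by auto
    have "atom_of \<Sigma> E X (tsubst \<sigma> t) \<in> teval (lang_op \<Sigma> E X) \<nu> t" if "t \<in> set ts" for t
      unfolding IH[OF that] using \<sigma> that by blast
    then have "list_all2 (\<in>) (map (\<lambda>t. atom_of \<Sigma> E X (tsubst \<sigma> t)) ts) (map (teval (lang_op \<Sigma> E X) \<nu>) ts)"
      by (simp add: list_all2_conv_all_nth)
    then show "a \<in> teval (lang_op \<Sigma> E X) \<nu> (Fun g ts)"
      unfolding teval.simps lang_op_def a op[OF \<sigma>, symmetric] by blast
  qed
qed

text \<open>By linearity both sides are sets of substitution instances, and by regularity the
  substitutions range under the same constraints. The two instances for one substitution are the
  same atom.\<close>

lemma teval_lang_op_equation: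
  assumes "(l, r) \<in> E" "\<And>v. \<nu> v \<subseteq> atoms \<Sigma> E X"
  shows "teval (lang_op \<Sigma> E X) \<nu> l = teval (lang_op \<Sigma> E X) \<nu> r"
proof -
  have lin: "distinct (occs l)" "distinct (occs r)" "set (occs l) = set (occs r)"
    using linear_regular assms(1) by (auto simp: linear_regular_def)
  have over: "trm_over \<Sigma> UNIV l" "trm_over \<Sigma> UNIV r"
    using equation_over assms(1) by auto
  have "atom_of \<Sigma> E X (tsubst \<sigma> l) = atom_of \<Sigma> E X (tsubst \<sigma> r)"
    if \<sigma>: "\<forall>v\<in>set (occs l). trm_over \<Sigma> X (\<sigma> v)" for \<sigma>
  proof -
    \<comment> \<open>The rule \<open>inst\<close> asks for a term over \<open>X\<close> at every variable, and \<open>tsubst \<sigma> l\<close> is one at hand.\<close>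
    let ?\<sigma> = "\<lambda>v. if v \<in> set (occs l) then \<sigma> v else tsubst \<sigma> l"
    have "(tsubst ?\<sigma> l, tsubst ?\<sigma> r) \<in> eq_theory \<Sigma> E X"
      using assms(1) \<sigma> over by (intro eq_theory.inst) (auto intro: trm_over_tsubst)
    moreover have "tsubst ?\<sigma> l = tsubst \<sigma> l" "tsubst ?\<sigma> r = tsubst \<sigma> r"
      using lin(3) by (auto intro: tsubst_cong)
    ultimately show ?thesis
      using eq_theory_over by (metis atom_of_eq_iff)
  qed
  then show ?thesis
    unfolding teval_lang_op_linear[OF over(1) lin(1) assms(2)] teval_lang_op_linear[OF over(2) lin(2) assms(2)]
      lin(3)[symmetric]
    by (intro Collect_cong ex_cong1) metis
qed

end

section \<open>Closed languages and their closure operator\<close>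

locale hypothesis_theory = linear_regular_theory \<Sigma> E
  for \<Sigma> :: "'f signature" and E :: "('f, 'v) equations" +
  fixes X :: "'x set" and H :: "('f, 'x) inequations"
  assumes hyps_closed: "(e, f) \<in> H \<Longrightarrow> closed_expr \<Sigma> X e \<and> closed_expr \<Sigma> X f"
begin

abbreviation closed :: "('f, 'x) lang \<Rightarrow> bool" where
  "closed \<equiv> hyp_closed \<Sigma> E X H"

abbreviation cl :: "('f, 'x) lang \<Rightarrow> ('f, 'x) lang" where
  "cl \<equiv> hyp_closure \<Sigma> E X H"

abbreviation op :: "'f \<Rightarrow> ('f, 'x) lang list \<Rightarrow> ('f, 'x) lang" where
  "op \<equiv> lang_op \<Sigma> E X"

lemma closed_subset: "closed K \<Longrightarrow> K \<subseteq> atoms \<Sigma> E X"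
  by (simp add: hyp_closed_def)

text \<open>Together with \<open>closedD\<close>, this lets closedness be handled by
  \<open>fill\<close> on terms instead of \<open>plug\<close> on classes.\<close>

lemma closedI:
  assumes "K \<subseteq> atoms \<Sigma> E X"
    and "\<And>c e f t. trm_over \<Sigma> (insert None (Some ` X)) c \<Longrightarrow> count_list (occs c) None = 1 \<Longrightarrow> (e, f) \<in> H \<Longrightarrow>
      (\<And>t. trm_over \<Sigma> X t \<Longrightarrow> atom_of \<Sigma> E X t \<in> lang_of \<Sigma> E X f \<Longrightarrow> atom_of \<Sigma> E X (fill c t) \<in> K) \<Longrightarrow>
      trm_over \<Sigma> X t \<Longrightarrow> atom_of \<Sigma> E X t \<in> lang_of \<Sigma> E X e \<Longrightarrow> atom_of \<Sigma> E X (fill c t) \<in> K"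
  shows "closed K"
proof -
  have "plug \<Sigma> E X C a \<in> K" if C: "C \<in> contexts \<Sigma> E X" and ef: "(e, f) \<in> H"
    and f: "plug \<Sigma> E X C ` lang_of \<Sigma> E X f \<subseteq> K" and a: "a \<in> lang_of \<Sigma> E X e" for C e f a
  proof -
    obtain c where c: "C = atom_of \<Sigma> E (insert None (Some ` X)) c"
      "trm_over \<Sigma> (insert None (Some ` X)) c" "count_list (occs c) None = 1"
      using C by (rule contextsE)
    obtain t where t: "a = atom_of \<Sigma> E X t" "trm_over \<Sigma> X t"
      using a lang_of_subset_atoms hyps_closed[OF ef] by (fastforce simp: atoms_eq)
    have "atom_of \<Sigma> E X (fill c s) \<in> K"
      if "trm_over \<Sigma> X s" "atom_of \<Sigma> E X s \<in> lang_of \<Sigma> E X f" for s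
      using f that c plug_atom_of[OF c(2), of s] by (metis image_subset_iff)
    then have "atom_of \<Sigma> E X (fill c t) \<in> K"
      using assms(2)[OF c(2,3) ef] t a by blast
    then show ?thesis
      using c t by (simp add: plug_atom_of)
  qed
  then have "hyp_step \<Sigma> E X H K \<subseteq> K"
    by (intro hyp_step_subsetI image_subsetI)
  then show ?thesis
    using assms(1) by (simp add: hyp_closed_def)
qed

lemma closedD:
  assumes "closed K" "trm_over \<Sigma> (insert None (Some ` X)) c" "count_list (occs c) None = 1" "(e, f) \<in> H"
    and f: "\<And>t. trm_over \<Sigma> X t \<Longrightarrow> atom_of \<Sigma> E X t \<in> lang_of \<Sigma> E X f \<Longrightarrow> atom_of \<Sigma> E X (fill c t) \<in> K"
    and t: "trm_over \<Sigma> X t" "atom_of \<Sigma> E X t \<in> lang_of \<Sigma> E X e"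
  shows "atom_of \<Sigma> E X (fill c t) \<in> K"
proof -
  let ?C = "atom_of \<Sigma> E (insert None (Some ` X)) c"
  have "lang_of \<Sigma> E X f \<subseteq> atoms \<Sigma> E X"
    using hyps_closed[OF assms(4)] lang_of_subset_atoms by blast
  then have "plug \<Sigma> E X ?C ` lang_of \<Sigma> E X f \<subseteq> K"
    using f assms(2) by (auto simp: atoms_eq plug_atom_of)
  then have "plug \<Sigma> E X ?C ` lang_of \<Sigma> E X e \<subseteq> hyp_step \<Sigma> E X H K"
    by (rule hyp_stepI[OF contextsI[OF assms(2,3)] assms(4)])
  then have "plug \<Sigma> E X ?C (atom_of \<Sigma> E X t) \<in> K"
    using assms(1) t by (auto simp: hyp_closed_def)
  then show ?thesis
    using assms(2) t(1) by (simp add: plug_atom_of)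
qed

sublocale moore: moore_family closed "atoms \<Sigma> E X"
proof
  show "closed (atoms \<Sigma> E X)"
    by (rule closedI) (auto intro: atom_of_in_atoms fill_over)
  show "K \<subseteq> atoms \<Sigma> E X" if "closed K" for K
    using that by (rule closed_subset)
  show "closed (\<Inter>\<A>)" if "\<A> \<noteq> {}" "\<And>K. K \<in> \<A> \<Longrightarrow> closed K" for \<A>
  proof -
    \<comment> \<open>Hypothesis steps are monotone, so a step from the intersection is a step from
      every member.\<close>
    have "hyp_step \<Sigma> E X H (\<Inter>\<A>) \<subseteq> K" if "K \<in> \<A>" for K
      using that \<open>\<And>K. K \<in> \<A> \<Longrightarrow> closed K\<close>[OF that] hyp_step_mono[of "\<Inter>\<A>" K \<Sigma> E X H]
      by (auto simp: hyp_closed_def)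
    then show ?thesis
      using that closed_subset unfolding hyp_closed_def by blast
  qed
qed

lemma closed_cl: "M \<subseteq> atoms \<Sigma> E X \<Longrightarrow> closed (cl M)"
  unfolding hyp_closure_def by (rule moore.hull_closed)

lemma cl_subset: "M \<subseteq> atoms \<Sigma> E X \<Longrightarrow> cl M \<subseteq> atoms \<Sigma> E X"
  by (rule closed_subset[OF closed_cl])

lemma subset_cl: "M \<subseteq> cl M"
  unfolding hyp_closure_def by (rule hull_subset)

lemma cl_minimal: "M \<subseteq> K \<Longrightarrow> closed K \<Longrightarrow> cl M \<subseteq> K"
  unfolding hyp_closure_def by (rule hull_minimal)

lemma cl_mono: "M \<subseteq> N \<Longrightarrow> cl M \<subseteq> cl N"
  unfolding hyp_closure_def by (rule hull_mono)

lemma cl_closed: "closed K \<Longrightarrow> cl K = K"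
  unfolding hyp_closure_def by (rule hull_same)

text \<open>A context placed below an operation is again a context.\<close>

lemma closed_residual:
  assumes K: "closed K" and sig: "(g, length (bs @ cs) + 1) \<in> \<Sigma>" and bc: "set (bs @ cs) \<subseteq> atoms \<Sigma> E X"
  shows "closed {a \<in> atoms \<Sigma> E X. atom_op \<Sigma> E X g (bs @ a # cs) \<in> K}"
proof -
  obtain ss where ss: "bs = map (atom_of \<Sigma> E X) ss" "\<forall>t\<in>set ss. trm_over \<Sigma> X t"
    using bc by (auto intro: atom_list_rep[of bs])
  obtain us where us: "cs = map (atom_of \<Sigma> E X) us" "\<forall>t\<in>set us. trm_over \<Sigma> X t"
    using bc by (auto intro: atom_list_rep[of cs])
  \<comment> \<open>Terms over \<open>X\<close> are seen as hole-free terms over the larger variable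
    set; filling a hole gives them back unchanged.\<close>
  let ?emb = "tsubst (\<lambda>x. Var (Some x))"
  let ?in = "\<lambda>c. Fun g (map ?emb ss @ c # map ?emb us)"
  have emb: "None \<notin> set (occs (?emb t))" "fill (?emb t) s = t" for t :: "('f, 'x) trm" and s
    by (auto simp: set_occs_tsubst fill_def tsubst_tsubst)
  have emb_over: "trm_over \<Sigma> (insert None (Some ` X)) (?emb t)" if "trm_over \<Sigma> X t" for t
    using that by (rule trm_over_tsubst) (use occs_subset[OF that] in auto)
  have in_over: "trm_over \<Sigma> (insert None (Some ` X)) (?in c)"
    if "trm_over \<Sigma> (insert None (Some ` X)) c" for c
    using that sig ss us emb_over by auto
  have in_count: "count_list (occs (?in c)) None = 1" if "count_list (occs c) None = 1" for c
  proof -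
    have "count_list (concat (map occs (map ?emb ts))) None = 0" for ts :: "('f, 'x) trm list"
      using emb(1) by (simp add: count_list_0_iff)
    with that show ?thesis by simp
  qed
  have in_fill: "atom_op \<Sigma> E X g (bs @ atom_of \<Sigma> E X (fill c t) # cs) = atom_of \<Sigma> E X (fill (?in c) t)"
    if "trm_over \<Sigma> (insert None (Some ` X)) c" "trm_over \<Sigma> X t" for c t
  proof -
    have "fill (?in c) t = Fun g (ss @ fill c t # us)"
      using emb(2)[of _ t] by (simp add: fill_def map_idI)
    then show ?thesis
      using atom_op_atom_of[of g "ss @ fill c t # us" X] ss us sig fill_over[OF that] by auto
  qed
  show ?thesis
  proof (rule closedI)
    fix c e f t
    assume c: "trm_over \<Sigma> (insert None (Some ` X)) c" "count_list (occs c) None = 1" and ef: "(e, f) \<in> H"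
      and f: "\<And>t. trm_over \<Sigma> X t \<Longrightarrow> atom_of \<Sigma> E X t \<in> lang_of \<Sigma> E X f \<Longrightarrow>
        atom_of \<Sigma> E X (fill c t) \<in> {a \<in> atoms \<Sigma> E X. atom_op \<Sigma> E X g (bs @ a # cs) \<in> K}"
      and t: "trm_over \<Sigma> X t" "atom_of \<Sigma> E X t \<in> lang_of \<Sigma> E X e"
    have "atom_of \<Sigma> E X (fill (?in c) t) \<in> K"
      using f by (intro closedD[OF K in_over[OF c(1)] in_count[OF c(2)] ef _ t]) (auto simp: in_fill[OF c(1)])
    then show "atom_of \<Sigma> E X (fill c t) \<in> {a \<in> atoms \<Sigma> E X. atom_op \<Sigma> E X g (bs @ a # cs) \<in> K}"
      using c t by (simp add: in_fill fill_over atom_of_in_atoms)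
  qed auto
qed

text \<open>With the other arguments fixed to atoms, the atoms \<open>b\<close> whose result lies in
  the closed right-hand side form a closed language by \<open>closed_residual\<close>. It contains
  \<open>M\<close>, hence \<open>cl M\<close>.\<close>

lemma op_cl_subset:
  assumes sig: "(g, length (Ls @ Ns) + 1) \<in> \<Sigma>"
    and sub: "\<forall>K\<in>set (Ls @ M # Ns). K \<subseteq> atoms \<Sigma> E X"
  shows "op g (Ls @ cl M # Ns) \<subseteq> cl (op g (Ls @ M # Ns))"
proof
  let ?K = "cl (op g (Ls @ M # Ns))"
  have K: "closed ?K"
    using sig sub by (intro closed_cl lang_op_subset_atoms) auto
  fix a assume "a \<in> op g (Ls @ cl M # Ns)"
  then obtain bs b cs where a: "a = atom_op \<Sigma> E X g (bs @ b # cs)" "b \<in> cl M"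
    and bc: "list_all2 (\<in>) bs Ls" "list_all2 (\<in>) cs Ns"
    by (auto simp: lang_op_def list_all2_mem_append3)
  let ?R = "{b \<in> atoms \<Sigma> E X. atom_op \<Sigma> E X g (bs @ b # cs) \<in> ?K}"
  have "closed ?R"
  proof (rule closed_residual[OF K])
    show "(g, length (bs @ cs) + 1) \<in> \<Sigma>"
      using sig bc by (simp add: list_all2_lengthD)
    show "set (bs @ cs) \<subseteq> atoms \<Sigma> E X"
      using list_all2_mem_subset[OF bc(1), of "atoms \<Sigma> E X"]
        list_all2_mem_subset[OF bc(2), of "atoms \<Sigma> E X"] sub by auto
  qed
  moreover have "atom_op \<Sigma> E X g (bs @ b # cs) \<in> ?K" if "b \<in> M" for b
    using that bc subset_cl[of "op g (Ls @ M # Ns)"] by (force simp: lang_op_def list_all2_mem_append3)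
  then have "M \<subseteq> ?R"
    using sub by auto
  ultimately have "cl M \<subseteq> ?R"
    by (intro cl_minimal)
  with a show "a \<in> ?K"
    by blast
qed

lemma op_map_cl_subset:
  assumes "(g, length Ls + length Ms) \<in> \<Sigma>" "\<forall>K\<in>set (Ls @ Ms). K \<subseteq> atoms \<Sigma> E X"
  shows "op g (Ls @ map cl Ms) \<subseteq> cl (op g (Ls @ Ms))"
  using assms
proof (induction Ms arbitrary: Ls)
  case Nil
  then show ?case by (simp add: subset_cl)
next
  case (Cons M Ms)
  have "op g (Ls @ map cl (M # Ms)) \<subseteq> cl (op g (Ls @ cl M # Ms))"
    using Cons.IH[of "Ls @ [cl M]"] Cons.prems cl_subset[of M] by simp
  also have "\<dots> \<subseteq> cl (op g (Ls @ M # Ms))"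
    using Cons.prems by (intro cl_minimal op_cl_subset closed_cl lang_op_subset_atoms) auto
  finally show ?case .
qed

lemma cl_op_map_cl:
  assumes "(g, length Ms) \<in> \<Sigma>" "\<forall>K\<in>set Ms. K \<subseteq> atoms \<Sigma> E X"
  shows "cl (op g (map cl Ms)) = cl (op g Ms)"
proof
  show "cl (op g (map cl Ms)) \<subseteq> cl (op g Ms)"
    using assms op_map_cl_subset[of g "[]" Ms] by (intro cl_minimal closed_cl lang_op_subset_atoms) auto
  show "cl (op g Ms) \<subseteq> cl (op g (map cl Ms))"
    by (intro cl_mono lang_op_mono) (simp add: list_all2_conv_all_nth subset_cl)
qed

text \<open>Inner closures are absorbed by the outermost one. An equation that holds for the
  pointwise operations is therefore inherited by the closed ones.\<close>

lemma teval_cl_op: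
  assumes "trm_over \<Sigma> V t" "\<And>v. closed (\<nu> v)"
  shows "teval (\<lambda>g Ls. cl (op g Ls)) \<nu> t = cl (teval op \<nu> t)"
  using assms(1)
proof (induction t)
  case (Var v)
  then show ?case using assms(2) by (simp add: cl_closed)
next
  case (Fun g ts)
  have "map (teval (\<lambda>g Ls. cl (op g Ls)) \<nu>) ts = map cl (map (teval op \<nu>) ts)"
    using Fun by simp
  moreover have "cl (op g (map cl (map (teval op \<nu>) ts))) = cl (op g (map (teval op \<nu>) ts))"
    using Fun.prems assms(2) closed_subset
    by (intro cl_op_map_cl) (auto dest!: teval_lang_op_subset[THEN subsetD, rotated 2])
  ultimately show ?case
    by (simp only: teval.simps)
qed

lemma op_Union:
  "op g (Ls @ \<Union>\<A> # Ns) = (\<Union>M\<in>\<A>. op g (Ls @ M # Ns))"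
  unfolding lang_op_def list_all2_mem_append3 by blast

lemma sup_closed_lattice: "\<A> \<subseteq> Collect closed \<Longrightarrow> \<Squnion>\<^bsub>set_lattice closed\<^esub>\<A> = cl (\<Union>\<A>)"
  unfolding hyp_closure_def by (rule moore.sup_set_lattice)

text \<open>Joins of closed languages are closures of unions, so this is continuity in one argument.
  The closure of the varying argument is absorbed by \<open>op_cl_subset\<close>, the pointwise
  operation distributes over unions, and the converse inclusion is monotonicity.\<close>

lemma cl_op_sup:
  assumes sig: "(g, length (Ls @ Ns) + 1) \<in> \<Sigma>" and LN: "set (Ls @ Ns) \<subseteq> Collect closed"
    and \<A>: "\<A> \<subseteq> Collect closed"
  shows "cl (op g (Ls @ cl (\<Union>\<A>) # Ns)) = cl (\<Union>M\<in>\<A>. cl (op g (Ls @ M # Ns)))"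
proof
  have sub: "K \<subseteq> atoms \<Sigma> E X" if "K \<in> set (Ls @ Ns) \<union> \<A>" for K
    using that LN \<A> closed_subset by blast
  have op_sub: "op g (Ls @ K # Ns) \<subseteq> atoms \<Sigma> E X" if "K \<subseteq> atoms \<Sigma> E X" for K
    using sig that sub by (intro lang_op_subset_atoms) auto
  let ?R = "\<Union>M\<in>\<A>. cl (op g (Ls @ M # Ns))"
  have R: "?R \<subseteq> atoms \<Sigma> E X"
    using sub by (intro UN_least cl_subset op_sub) blast
  have "op g (Ls @ cl (\<Union>\<A>) # Ns) \<subseteq> cl (op g (Ls @ \<Union>\<A> # Ns))"
    using sig sub by (intro op_cl_subset) auto
  also have "op g (Ls @ \<Union>\<A> # Ns) \<subseteq> ?R"
    unfolding op_Union using subset_cl by blast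
  then have "cl (op g (Ls @ \<Union>\<A> # Ns)) \<subseteq> cl ?R"
    by (rule cl_mono)
  finally show "cl (op g (Ls @ cl (\<Union>\<A>) # Ns)) \<subseteq> cl ?R"
    using R by (intro cl_minimal closed_cl)
  have "cl (op g (Ls @ M # Ns)) \<subseteq> cl (op g (Ls @ cl (\<Union>\<A>) # Ns))" if "M \<in> \<A>" for M
    using that subset_cl[of "\<Union>\<A>"]
    by (intro cl_mono lang_op_mono list_all2_appendI) (auto simp: list_all2_conv_all_nth[of _ Ls]
        intro!: list_all2_refl)
  moreover have "\<Union>\<A> \<subseteq> atoms \<Sigma> E X"
    using sub by blast
  then have "closed (cl (op g (Ls @ cl (\<Union>\<A>) # Ns)))"
    by (intro closed_cl op_sub cl_subset)
  ultimately show "cl ?R \<subseteq> cl (op g (Ls @ cl (\<Union>\<A>) # Ns))"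
    by - (rule cl_minimal, rule UN_least, simp_all)
qed

lemma closed_model: "continuous_model \<Sigma> E (set_lattice closed) (\<lambda>g Ls. cl (op g Ls))"
proof -
  have "complete_lattice (set_lattice closed)"
    by (rule moore.complete_lattice_set_lattice)
  moreover have "closed (cl (op g Ls))" if "(g, length Ls) \<in> \<Sigma>" "set Ls \<subseteq> Collect closed" for g Ls
    using that closed_subset by (intro closed_cl lang_op_subset_atoms) auto
  moreover have "cl (op g (Ls[i := \<Squnion>\<^bsub>set_lattice closed\<^esub>\<A>])) =
      \<Squnion>\<^bsub>set_lattice closed\<^esub>((\<lambda>M. cl (op g (Ls[i := M]))) ` \<A>)"
    if "(g, length Ls) \<in> \<Sigma>" "set Ls \<subseteq> Collect closed" "i < length Ls" "\<A> \<subseteq> Collect closed" for g Ls i \<A>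
  proof -
    have len: "length (take i Ls @ drop (Suc i) Ls) + 1 = length Ls"
      using that(3) by simp
    have sets: "set (take i Ls @ drop (Suc i) Ls) \<subseteq> Collect closed"
      using that(2) by (auto dest: in_set_takeD in_set_dropD)
    have image: "(\<lambda>M. cl (op g (take i Ls @ M # drop (Suc i) Ls))) ` \<A> \<subseteq> Collect closed"
    proof (intro image_subsetI CollectI closed_cl lang_op_subset_atoms)
      fix M assume "M \<in> \<A>"
      then have "set (take i Ls @ M # drop (Suc i) Ls) \<subseteq> Collect closed"
        using sets that(4) by auto
      then show "\<forall>K\<in>set (take i Ls @ M # drop (Suc i) Ls). K \<subseteq> atoms \<Sigma> E X"
        using closed_subset by blast
      have "length (take i Ls @ M # drop (Suc i) Ls) = length Ls"
        unfolding len[symmetric] by simp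
      with that(1) show "(g, length (take i Ls @ M # drop (Suc i) Ls)) \<in> \<Sigma>"
        by (simp only:)
    qed
    show ?thesis
      unfolding upd_conv_take_nth_drop[OF that(3)] sup_closed_lattice[OF that(4)] sup_closed_lattice[OF image]
      using that(1,4) sets by (intro cl_op_sup) (simp_all only: len)
  qed
  moreover have "teval (\<lambda>g Ls. cl (op g Ls)) \<nu> l = teval (\<lambda>g Ls. cl (op g Ls)) \<nu> r"
    if "(l, r) \<in> E" "\<forall>v. closed (\<nu> v)" for l r \<nu>
  proof -
    have "teval op \<nu> l = teval op \<nu> r"
      using that closed_subset by (intro teval_lang_op_equation) auto
    then show ?thesis
      using that(2) equation_over[OF that(1)] by (simp add: teval_cl_op[of UNIV])
  qed
  ultimately show ?thesis
    unfolding continuous_model_def by (simp add: case_prod_unfold split_paired_all)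
qed

section \<open>The canonical model and completeness\<close>

sublocale model: valued_algebra \<Sigma> E "set_lattice closed" "\<lambda>g Ls. cl (op g Ls)" X
  "\<lambda>x. cl {atom_of \<Sigma> E X (Var x)}"
proof -
  interpret complete_lattice "set_lattice closed"
    by (rule moore.complete_lattice_set_lattice)
  show "valued_algebra \<Sigma> E (set_lattice closed) (\<lambda>g Ls. cl (op g Ls)) X (\<lambda>x. cl {atom_of \<Sigma> E X (Var x)})"
    by unfold_locales (auto intro!: closed_model closed_cl atom_of_in_atoms)
qed

lemma teval_model:
  assumes "trm_over \<Sigma> X t"
  shows "teval (\<lambda>g Ls. cl (op g Ls)) (\<lambda>x. cl {atom_of \<Sigma> E X (Var x)}) t = cl {atom_of \<Sigma> E X t}"
  using assms
proof (induction t)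
  case (Var x)
  then show ?case by simp
next
  case (Fun g ts)
  let ?Ms = "map (\<lambda>t. {atom_of \<Sigma> E X t}) ts"
  have "map (teval (\<lambda>g Ls. cl (op g Ls)) (\<lambda>x. cl {atom_of \<Sigma> E X (Var x)})) ts = map cl ?Ms"
    using Fun by simp
  moreover have "cl (op g (map cl ?Ms)) = cl (op g ?Ms)"
    using Fun.prems by (intro cl_op_map_cl) (auto intro: atom_of_in_atoms)
  moreover have "list_all2 (\<in>) as ?Ms \<longleftrightarrow> as = map (atom_of \<Sigma> E X) ts" for as
    by (auto simp: list_all2_conv_all_nth intro: nth_equalityI)
  then have "op g ?Ms = {atom_of \<Sigma> E X (Fun g ts)}"
    using Fun.prems atom_op_atom_of[of g ts X] by (simp add: lang_op_def)
  ultimately show ?case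
    by (simp only: teval.simps)
qed

text \<open>By \<open>teval_model\<close>, the generators of \<open>model.lift M\<close> are the
  closures of the single atoms of \<open>M\<close>. Their join is the closure of their union, which
  lies between \<open>M\<close> and \<open>cl M\<close>.\<close>

lemma lift_model:
  assumes M: "M \<subseteq> atoms \<Sigma> E X"
  shows "model.lift M = cl M"
proof -
  let ?A = "{cl {atom_of \<Sigma> E X t} | t. trm_over \<Sigma> X t \<and> atom_of \<Sigma> E X t \<in> M}"
  have "?A \<subseteq> Collect closed"
    by (auto intro!: closed_cl atom_of_in_atoms)
  moreover have "model.lift M = \<Squnion>\<^bsub>set_lattice closed\<^esub>?A"
    unfolding model.lift_def
    by (intro arg_cong[where f = "Lattice.sup _"] Collect_cong ex_cong1) (metis teval_model)
  ultimately have "model.lift M = cl (\<Union>?A)"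
    by (simp only: sup_closed_lattice)
  moreover have "\<Union>?A \<subseteq> cl M"
    using cl_mono[of "{_}" M] by auto
  then have "cl (\<Union>?A) \<subseteq> cl M"
    using M by (intro cl_minimal closed_cl)
  moreover have "M \<subseteq> \<Union>?A"
  proof
    fix a assume a: "a \<in> M"
    then obtain t where "a = atom_of \<Sigma> E X t" "trm_over \<Sigma> X t"
      using M by (auto simp: atoms_eq)
    then show "a \<in> \<Union>?A"
      using a subset_cl[of "{a}"] by auto
  qed
  then have "cl M \<subseteq> cl (\<Union>?A)"
    by (rule cl_mono)
  ultimately show ?thesis
    by (simp only: subset_antisym)
qed

lemma interp_model:
  assumes "closed_expr \<Sigma> X e"
  shows "interp (set_lattice closed) (\<lambda>g Ls. cl (op g Ls)) (\<lambda>x. cl {atom_of \<Sigma> E X (Var x)}) e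
    = cl (lang_of \<Sigma> E X e)"
  using model.lift_lang_of[OF assms] lift_model[OF lang_of_subset_atoms[OF assms]] by simp

text \<open>The hole alone is a context and filling it returns the plugged term, so the hypothesis
  itself is an instance of a closure step.\<close>

lemma cl_hyp:
  assumes "(e, f) \<in> H"
  shows "cl (lang_of \<Sigma> E X e) \<subseteq> cl (lang_of \<Sigma> E X f)"
proof -
  have e: "lang_of \<Sigma> E X e \<subseteq> atoms \<Sigma> E X" and f: "lang_of \<Sigma> E X f \<subseteq> atoms \<Sigma> E X"
    using hyps_closed[OF assms] lang_of_subset_atoms by blast+
  have fill: "fill (Var None) t = t" for t :: "('f, 'x) trm"
    by (simp add: fill_def)
  have "atom_of \<Sigma> E X t \<in> cl (lang_of \<Sigma> E X f)"
    if "trm_over \<Sigma> X t" "atom_of \<Sigma> E X t \<in> lang_of \<Sigma> E X e" for t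
    using closedD[OF closed_cl[OF f] _ _ assms _ that, of "Var None"] subset_cl[of "lang_of \<Sigma> E X f"]
    by (auto simp: fill)
  then have "lang_of \<Sigma> E X e \<subseteq> cl (lang_of \<Sigma> E X f)"
    using e by (auto simp: atoms_eq)
  then show ?thesis
    using f by (intro cl_minimal closed_cl)
qed

lemma entails_imp_cl_subset:
  assumes "closed_expr \<Sigma> X e" "closed_expr \<Sigma> X f" "entails TYPE(('f, 'x) lang) \<Sigma> X E H e f"
  shows "cl (lang_of \<Sigma> E X e) \<subseteq> cl (lang_of \<Sigma> E X f)"
proof -
  let ?I = "interp (set_lattice closed) (\<lambda>g Ls. cl (op g Ls)) (\<lambda>x. cl {atom_of \<Sigma> E X (Var x)})"
  have "?I e' \<sqsubseteq>\<^bsub>set_lattice closed\<^esub> ?I f'" if "(e', f') \<in> H" for e' f'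
    using cl_hyp[OF that] hyps_closed[OF that] by (simp add: interp_model)
  then have hyps: "\<forall>(e', f')\<in>H. ?I e' \<sqsubseteq>\<^bsub>set_lattice closed\<^esub> ?I f'"
    by blast
  have valuation: "\<forall>x\<in>X. cl {atom_of \<Sigma> E X (Var x)} \<in> carrier (set_lattice closed)"
    using model.valuation by blast
  have "?I e \<sqsubseteq>\<^bsub>set_lattice closed\<^esub> ?I f"
    by (rule assms(3)[unfolded entails_def, THEN spec, THEN spec, THEN spec, THEN mp, THEN mp, THEN mp,
          OF closed_model valuation hyps])
  then show ?thesis
    using assms(1,2) by (simp add: interp_model)
qed

end

text \<open>The canonical model lives in the type of languages, so validity at that type alone
  yields the inclusion. The second conjunct carries soundness at an arbitrary type
  \<open>'a\<close>, over which the formula cannot quantify.\<close>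

theorem theorem4p1:
  fixes \<Sigma> :: "'f signature" and X :: "'x set" and E :: "('f, 'v) equations"
    and H :: "('f, 'x) inequations" and e f :: "('f, 'x) expr"
  assumes "linear_regular \<Sigma> E"
    and "\<forall>(e', f')\<in>H. closed_expr \<Sigma> X e' \<and> closed_expr \<Sigma> X f'"
    and "closed_expr \<Sigma> X e" and "closed_expr \<Sigma> X f"
  shows "(entails TYPE(('f, 'x) lang) \<Sigma> X E H e f \<longleftrightarrow>
            hyp_closure \<Sigma> E X H (lang_of \<Sigma> E X e) \<subseteq> hyp_closure \<Sigma> E X H (lang_of \<Sigma> E X f))
       \<and> (hyp_closure \<Sigma> E X H (lang_of \<Sigma> E X e) \<subseteq> hyp_closure \<Sigma> E X H (lang_of \<Sigma> E X f) \<longrightarrow>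
            entails TYPE('a) \<Sigma> X E H e f)"
proof -
  interpret hypothesis_theory \<Sigma> E X H
    using assms(1,2) by unfold_locales auto
  show ?thesis
    by (intro conjI iffI impI)
      (erule entails_imp_cl_subset[OF assms(3,4)] hyp_closure_imp_entails[OF assms])+
qed

end
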